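(* For $0<\rho\le\frac13$ and $k=0,1$ let $\Pi_k(\rho)$ denote the quasi-interpolation operator defined in the context, and set $\mathbb P\Lambda^0=\mathbb P_3$, $\mathbb P\Lambda^1=\mathbb P_2$. Then, for $k=0,1$ and every $p\in\mathbb P\Lambda^k$, $$\Pi_k(\rho)p\to I_kp=p\qquad\text{as }\rho\to0.$$ Consequently, for all sufficiently small $\rho$ the restriction $\Pi_k(\rho)|_{\mathbb P\Lambda^k}\colon\mathbb P\Lambda^k\to\mathbb P\Lambda^k$ is invertible, and the operator $$\hat\Pi_k=\bigl(\Pi_k(\rho)|_{\mathbb P\Lambda^k}\bigr)^{-1}\Pi_k(\rho)$$ has the projection property, i.e. $\hat\Pi_kp=p$ for all $p\in\mathbb P\Lambda^k$.
   Context: On an interval, $0$-forms are functions and $1$-forms $v\,dx$ are identified with their coefficient $v$. $\mathbb P_m$ is the space of polynomials of degree at most $m$ in one variable; polynomials on $[0,1]$ are identified with their extensions to $\mathcal I_\rho=[-\rho,1+\rho]$. Canonical interpolation on $[0,1]$: $I_0u=\sum_{i=1}^4\mathcal N^0_i(u)\varphi^0_i$, $I_1v=\sum_{i=1}^3\mathcal N^1_i(v)\varphi^1_i$, with $\mathcal N^0_1(u)=u'(0)$, $\mathcal N^0_2(u)=u'(1)$, $\mathcal N^0_3(u)=u(1)-u(0)$, $\mathcal N^0_4(u)=u(1)+u(0)$, $\mathcal N^1_1(v)=v(0)$, $\mathcal N^1_2(v)=v(1)$, $\mathcal N^1_3(v)=\int_0^1v\,dx$, and basis functions $\varphi^0_1=x-2x^2+x^3$,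 $\varphi^0_2=-x^2+x^3$, $\varphi^0_3=-\frac12+3x^2-2x^3$, $\varphi^0_4=\frac12$; $\varphi^1_1=1-4x+3x^2$, $\varphi^1_2=-2x+3x^2$, $\varphi^1_3=6x-6x^2$. Cut-off functions: $\eta(x)=C\exp\bigl(\frac1{|x|^2-1}\bigr)$ for $|x|<1$, $\eta(x)=0$ for $|x|\ge1$, with $\int_{\mathbb R}\eta=1$; $\eta_l(x)=\frac1\rho\eta(\frac x\rho)$, $\eta_r(x)=\frac1\rho\eta(\frac{x-1}\rho)$; $B_l$, $B_r$ are the intervals of radius $\rho$ centered at $0$ and $1$. For $y_l\in B_l$, $y_r\in B_r$, perturbed node functionals: $\widetilde{\mathcal N^0_1}(u)=u'(y_l)$, $\widetilde{\mathcal N^0_2}(u)=u'(y_r)$, $\widetilde{\mathcal N^0_3}(u)=u(y_r)-u(y_l)$, $\widetilde{\mathcal N^0_4}(u)=u(y_r)+u(y_l)$; $\widetilde{\mathcal N^1_1}(v)=v(y_l)$, $\widetilde{\mathcal N^1_2}(v)=v(y_r)$, $\widetilde{\mathcal N^1_3}(v)=\int_{y_l}^{y_r}v\,dx$. Weighted node functionals: $\overline{\mathcal N^k_i}(u)=\int_{B_l}\int_{B_r}\eta_l(\xi_l)\eta_r(\xi_r)\widetilde{\mathcal N^k_i}(u)\,d\xi_r\,d\xi_l$, with $y_l=\xi_l$, $y_r=\xi_r$; these are $L^2(\mathcal I_\rho)$-bounded and extended by continuity to $L^2(\mathcal I_\rho)$. Quasi-interpolation operators: $\Pi_0(\rho)u=\sum_{i=1}^4\overline{\mathcal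 N^0_i}(u)\varphi^0_i$ and $\Pi_1(\rho)v=\sum_{i=1}^3\overline{\mathcal N^1_i}(v)\varphi^1_i$, with values in $\mathbb P_3$ and $\mathbb P_2$ respectively. *)

theory Defs
  imports "HOL-Analysis.Analysis" "HOL-Computational_Algebra.Polynomial"
begin

text \<open>
  A 0-form on an interval is a function \<open>real \<Rightarrow> real\<close> and a 1-form \<open>v dx\<close> is its coefficient \<open>v\<close>.
  A polynomial on \<open>[0,1]\<close>, identified with its extensions, is a polynomial function on the whole line.
\<close>

definition poly_space :: "nat \<Rightarrow> (real \<Rightarrow> real) set" where
  "poly_space m = {poly p | p. degree p \<le> m}"

definition poly_form :: "nat \<Rightarrow> (real \<Rightarrow> real) set" where
  "poly_form k = (if k = 0 then poly_space 3 else poly_space 2)"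

definition I_ext :: "real \<Rightarrow> real set" where
  "I_ext \<rho> = {-\<rho>..1 + \<rho>}"

definition basis0 :: "nat \<Rightarrow> real \<Rightarrow> real" where
  "basis0 i x =
    (if i = 1 then x - 2 * x^2 + x^3
     else if i = 2 then - (x^2) + x^3
     else if i = 3 then - (1/2) + 3 * x^2 - 2 * x^3
     else 1/2)"

definition basis1 :: "nat \<Rightarrow> real \<Rightarrow> real" where
  "basis1 i x =
    (if i = 1 then 1 - 4 * x + 3 * x^2
     else if i = 2 then - 2 * x + 3 * x^2
     else 6 * x - 6 * x^2)"

definition node0 :: "nat \<Rightarrow> (real \<Rightarrow> real) \<Rightarrow> real" where
  "node0 i u =
    (if i = 1 then vector_derivative u (at 0 within {0..1})
     else if i = 2 then vector_derivative u (at 1 within {0..1})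
     else if i = 3 then u 1 - u 0
     else u 1 + u 0)"

definition node1 :: "nat \<Rightarrow> (real \<Rightarrow> real) \<Rightarrow> real" where
  "node1 i v =
    (if i = 1 then v 0
     else if i = 2 then v 1
     else (LINT x|lebesgue_on {0..1}. v x))"

definition interp :: "nat \<Rightarrow> (real \<Rightarrow> real) \<Rightarrow> real \<Rightarrow> real" where
  "interp k u =
    (if k = 0 then (\<lambda>x. \<Sum>i=1..4. node0 i u * basis0 i x)
     else (\<lambda>x. \<Sum>i=1..3. node1 i u * basis1 i x))"

definition bump :: "real \<Rightarrow> real" where
  "bump x = (if \<bar>x\<bar> < 1 then exp (1 / (\<bar>x\<bar>^2 - 1)) else 0)"

definition eta :: "real \<Rightarrow> real" where
  "eta x = (1 / (LINT t|lebesgue. bump t)) * bump x"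

definition eta_l :: "real \<Rightarrow> real \<Rightarrow> real" where
  "eta_l \<rho> x = 1 / \<rho> * eta (x / \<rho>)"

definition eta_r :: "real \<Rightarrow> real \<Rightarrow> real" where
  "eta_r \<rho> x = 1 / \<rho> * eta ((x - 1) / \<rho>)"

definition pert_node0 :: "nat \<Rightarrow> real \<Rightarrow> real \<Rightarrow> (real \<Rightarrow> real) \<Rightarrow> real" where
  "pert_node0 i yl yr u =
    (if i = 1 then deriv u yl
     else if i = 2 then deriv u yr
     else if i = 3 then u yr - u yl
     else u yr + u yl)"

text \<open>For \<open>\<rho> \<le> 1/3\<close>, every \<open>yl\<close> in the left ball is smaller than every \<open>yr\<close> in the right one,
  so the integral from \<open>yl\<close> to \<open>yr\<close> is the one over the set \<open>{yl..yr}\<close>.\<close>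

definition pert_node1 :: "nat \<Rightarrow> real \<Rightarrow> real \<Rightarrow> (real \<Rightarrow> real) \<Rightarrow> real" where
  "pert_node1 i yl yr v =
    (if i = 1 then v yl
     else if i = 2 then v yr
     else (LINT x|lebesgue_on {yl..yr}. v x))"

definition weighted_avg :: "real \<Rightarrow> (real \<Rightarrow> real \<Rightarrow> (real \<Rightarrow> real) \<Rightarrow> real) \<Rightarrow> (real \<Rightarrow> real) \<Rightarrow> real" where
  "weighted_avg \<rho> N u =
    (LINT \<xi>l|lebesgue_on (ball 0 \<rho>). LINT \<xi>r|lebesgue_on (ball 1 \<rho>).
       eta_l \<rho> \<xi>l * eta_r \<rho> \<xi>r * N \<xi>l \<xi>r u)"

definition L2_on :: "real set \<Rightarrow> (real \<Rightarrow> real) set" where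
  "L2_on S = {u. u \<in> borel_measurable (lebesgue_on S) \<and> integrable (lebesgue_on S) (\<lambda>x. (u x)^2)}"

text \<open>Extension by continuity to \<open>L2_on S\<close> of an \<open>L\<^sup>2\<close>-bounded functional \<open>F\<close> given on an
  \<open>L\<^sup>2\<close>-dense set \<open>D\<close>: the common limit of \<open>F\<close> along all sequences in \<open>D\<close> that converge to \<open>u\<close>
  in \<open>L\<^sup>2\<close>.\<close>

definition L2_extension ::
    "real set \<Rightarrow> (real \<Rightarrow> real) set \<Rightarrow> ((real \<Rightarrow> real) \<Rightarrow> real) \<Rightarrow> (real \<Rightarrow> real) \<Rightarrow> real" where
  "L2_extension S D F =
    (\<lambda>u\<in>L2_on S. THE c. \<forall>w :: nat \<Rightarrow> real \<Rightarrow> real.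
       (\<forall>n. w n \<in> D) \<longrightarrow>
       (\<lambda>n. LINT x|lebesgue_on S. (w n x - u x)^2) \<longlonglongrightarrow> 0 \<longrightarrow>
       (\<lambda>n. F (w n)) \<longlonglongrightarrow> c)"

text \<open>The averages are evaluated directly where the perturbed functionals make sense classically:
  on continuously differentiable 0-forms and on continuous 1-forms.\<close>

definition weighted_node0 :: "real \<Rightarrow> nat \<Rightarrow> (real \<Rightarrow> real) \<Rightarrow> real" where
  "weighted_node0 \<rho> i =
    L2_extension (I_ext \<rho>) {u. u C1_differentiable_on I_ext \<rho>} (weighted_avg \<rho> (pert_node0 i))"

definition weighted_node1 :: "real \<Rightarrow> nat \<Rightarrow> (real \<Rightarrow> real) \<Rightarrow> real" where
  "weighted_node1 \<rho> i =
    L2_extension (I_ext \<rho>) {v. continuous_on (I_ext \<rho>) v} (weighted_avg \<rho> (pert_node1 i))"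

definition quasi_interp :: "nat \<Rightarrow> real \<Rightarrow> (real \<Rightarrow> real) \<Rightarrow> real \<Rightarrow> real" where
  "quasi_interp k \<rho> u =
    (if k = 0 then (\<lambda>x. \<Sum>i=1..4. weighted_node0 \<rho> i u * basis0 i x)
     else (\<lambda>x. \<Sum>i=1..3. weighted_node1 \<rho> i u * basis1 i x))"

definition quasi_interp_hat :: "nat \<Rightarrow> real \<Rightarrow> (real \<Rightarrow> real) \<Rightarrow> real \<Rightarrow> real" where
  "quasi_interp_hat k \<rho> = inv_into (poly_form k) (quasi_interp k \<rho>) \<circ> quasi_interp k \<rho>"

end

theory Submission
  imports Defs "HOL-Real_Asymp.Real_Asymp"
begin

text \<open>
  Every polynomial is smooth, so for it the averaged functionals are classical averages with weights
  of integral 1 concentrating at the points 0 and 1, and they converge to the unperturbed node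
  functionals.  In the basis dual to the node functionals \<open>\<Pi>\<^sub>k(\<rho>)\<close> is therefore given by a matrix that
  tends to the identity, hence is invertible for small \<open>\<rho>\<close>.  That the extension by continuity agrees
  with the classical average amounts to an \<open>L\<^sup>1\<close> bound, which integration by parts gives for the
  functionals involving a derivative; the integral functional becomes a difference of two point values
  after passing to an antiderivative.
\<close>

subsection \<open>The cut-off function\<close>

text \<open>\<open>L2_extension\<close> is a definite description over all approximating sequences,
  so nothing is known about the weighted functionals, not even linearity, before they are identified
  with classical averages. An L1 bound suffices for this because the intervals are bounded, so that
  L2 convergence implies L1 convergence. The double average is tamed by a common shape: every
  perturbed functional is a combination of a value at the left node and a value at the right node.
  Each weight has integral 1, so the average separates into two one-dimensional mollified values,
  and linearity, bounds and limits are all read off from \<open>moll\<close>. The derivative is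
  moved onto the cut-off only once, so C1 regularity of the cut-off is enough. The interval
  \<open>I_ext \<rho>\<close> changes with \<open>\<rho>\<close>. The limits are therefore taken for
  a function fixed on the largest interval, with \<open>\<rho> = 1/3\<close>, and restricted to the
  smaller ones.\<close>

lemma tendsto_0_if_pos:
  fixes g :: "real \<Rightarrow> real"
  assumes "(g \<longlongrightarrow> 0) (at_right 0)"
  shows "((\<lambda>t. if 0 < t then g t else 0) \<longlongrightarrow> 0) (at 0)"
proof (rule filterlim_split_at)
  show "((\<lambda>t. if 0 < t then g t else 0) \<longlongrightarrow> 0) (at_left 0)"
    by (rule tendsto_eventually) (auto simp: eventually_at_filter)
  show "((\<lambda>t. if 0 < t then g t else 0) \<longlongrightarrow> 0) (at_right 0)"
    by (rule Lim_transform_eventually[OF assms]) (auto simp: eventually_at_filter)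
qed

text \<open>Away from 0 the function is locally elementary. At 0 both the difference quotient and
  the derivative are \<open>exp (- 1 / t)\<close> times a power of \<open>1 / t\<close> on the right
  and zero on the left, so the exponential decay kills them.\<close>

lemma C1_exp_minus_inverse:
  obtains h' :: "real \<Rightarrow> real" where
    "\<And>t. ((\<lambda>t. if 0 < t then exp (- 1 / t) else 0) has_real_derivative h' t) (at t)"
    "continuous_on UNIV h'"
proof -
  define h :: "real \<Rightarrow> real" where "h = (\<lambda>t. if 0 < t then exp (- 1 / t) else 0)"
  define h' :: "real \<Rightarrow> real" where "h' = (\<lambda>t. if 0 < t then exp (- 1 / t) / t\<^sup>2 else 0)"
  have "(h has_real_derivative h' t) (at t) \<and> isCont h' t" for t
  proof -
    consider "t > 0" | "t < 0" | "t = 0" by linarith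
    then show ?thesis
    proof cases
      case 1
      then have ev: "\<forall>\<^sub>F s in nhds t. s > 0"
        by (intro eventually_nhds_in_open[of "{0<..}", simplified]) auto
      have "((\<lambda>t. exp (- 1 / t)) has_real_derivative h' t) (at t)"
        using 1 by (auto intro!: derivative_eq_intros simp: h'_def power2_eq_square)
      then have "(h has_real_derivative h' t) (at t)"
        by (rule DERIV_cong_ev[THEN iffD2, rotated -1])
           (use ev in \<open>auto simp: h_def elim!: eventually_mono\<close>)
      moreover have "isCont (\<lambda>t. exp (- 1 / t) / t\<^sup>2) t"
        using 1 by (intro continuous_intros) auto
      then have "isCont h' t"
        by (rule isCont_cong[THEN iffD2, rotated])
           (use ev in \<open>auto simp: h'_def elim!: eventually_mono\<close>)
      ultimately show ?thesis by blast
    next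
      case 2
      then have ev: "\<forall>\<^sub>F s in nhds t. s < 0"
        by (intro eventually_nhds_in_open[of "{..<0}", simplified]) auto
      have "((\<lambda>t. 0) has_real_derivative h' t) (at t)"
        using 2 by (auto simp: h'_def)
      then have "(h has_real_derivative h' t) (at t)"
        by (rule DERIV_cong_ev[THEN iffD2, rotated -1])
           (use ev in \<open>auto simp: h_def elim!: eventually_mono\<close>)
      moreover have "isCont (\<lambda>t. 0::real) t" by simp
      then have "isCont h' t"
        by (rule isCont_cong[THEN iffD2, rotated])
           (use ev in \<open>auto simp: h'_def elim!: eventually_mono\<close>)
      ultimately show ?thesis by blast
    next
      case 3
      have "((\<lambda>t. if 0 < t then exp (- 1 / t) / t else 0) \<longlongrightarrow> (0::real)) (at 0)"
        by (rule tendsto_0_if_pos) real_asymp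
      then have "((\<lambda>t. h t / t) \<longlongrightarrow> 0) (at 0)"
        by (rule Lim_transform_eventually) (auto simp: h_def eventually_at_filter)
      moreover have "h 0 = 0" "h' 0 = 0" by (auto simp: h_def h'_def)
      ultimately have "(h has_real_derivative h' 0) (at 0)"
        by (simp add: DERIV_def)
      moreover have "(h' \<longlongrightarrow> 0) (at 0)"
        unfolding h'_def by (rule tendsto_0_if_pos) real_asymp
      then have "isCont h' 0" by (simp add: isCont_def h'_def)
      ultimately show ?thesis using 3 by blast
    qed
  qed
  then show ?thesis
    using that[of h'] by (auto simp: h_def continuous_on_eq_continuous_at)
qed

text \<open>Written as the flat function composed with \<open>1 - x\<^sup>2\<close>, the bump needs
  no separate treatment of the gluing points -1 and 1: the chain rule covers them.\<close>

lemma bump_C1: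
  obtains b' where "\<And>x. (bump has_real_derivative b' x) (at x)" "continuous_on UNIV b'"
proof -
  obtain h' :: "real \<Rightarrow> real" where h':
    "\<And>t. ((\<lambda>t. if 0 < t then exp (- 1 / t) else 0) has_real_derivative h' t) (at t)"
    and c: "continuous_on UNIV h'"
    by (rule C1_exp_minus_inverse) blast
  have bump_eq: "bump = (\<lambda>x. if 0 < 1 - x\<^sup>2 then exp (- 1 / (1 - x\<^sup>2)) else 0)"
  proof
    fix x :: real
    have "- 1 / (1 - x\<^sup>2) = 1 / (x\<^sup>2 - 1)" by (metis minus_diff_eq minus_divide_divide minus_minus)
    moreover have "0 < 1 - x\<^sup>2 \<longleftrightarrow> \<bar>x\<bar> < 1" by (simp add: abs_square_less_1)
    ultimately show "bump x = (if 0 < 1 - x\<^sup>2 then exp (- 1 / (1 - x\<^sup>2)) else 0)"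
      by (simp add: bump_def)
  qed
  have "(bump has_real_derivative h' (1 - x\<^sup>2) * (- 2 * x)) (at x)" for x
    unfolding bump_eq
    by (rule DERIV_chain2[OF h', of "\<lambda>x. 1 - x\<^sup>2"]) (auto intro!: derivative_eq_intros)
  moreover have "continuous_on UNIV (\<lambda>x. h' (1 - x\<^sup>2) * (- 2 * x))"
    by (intro continuous_intros continuous_on_compose2[OF c]) auto
  ultimately show ?thesis by (rule that)
qed

lemma continuous_on_bump: "continuous_on S bump"
  using bump_C1 by (metis DERIV_isCont continuous_at_imp_continuous_on)

lemma LINT_bump: "(LINT t|lebesgue. bump t) = integral {-1..1} bump"
proof -
  have "(LINT t|lebesgue. bump t) = (LINT t|lebesgue. (if t \<in> {-1..1} then bump t else 0))"
    by (intro Bochner_Integration.integral_cong) (auto simp: bump_def)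
  also have "\<dots> = integral {-1..1} bump"
    by (subst Lebesgue_Measure.integral_restrict_UNIV)
       (auto simp: continuous_on_bump continuous_imp_integrable_real lebesgue_integral_eq_integral)
  finally show ?thesis .
qed

text \<open>Division by zero yields zero, so this positivity is what makes the normalisation in
  \<open>eta\<close> effective.\<close>

lemma LINT_bump_pos: "0 < (LINT t|lebesgue. bump t)"
proof -
  have "integral {-1..1::real} (\<lambda>_. 0) < integral {-1..1} bump"
    by (rule integral_less_real[OF _ continuous_on_bump]) (auto simp: bump_def)
  then show ?thesis by (simp add: LINT_bump)
qed

lemma eta_nonneg: "0 \<le> eta x"
  using LINT_bump_pos by (simp add: eta_def bump_def)

lemma eta_C1:
  obtains e' where "\<And>x. (eta has_real_derivative e' x) (at x)" "continuous_on UNIV e'"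
proof -
  obtain b' where b': "\<And>x. (bump has_real_derivative b' x) (at x)" and c: "continuous_on UNIV b'"
    by (rule bump_C1) blast
  have "(eta has_real_derivative (1 / (LINT t|lebesgue. bump t)) * b' x) (at x)" for x
    unfolding eta_def by (rule DERIV_cmult[OF b'])
  moreover have "continuous_on UNIV (\<lambda>x. (1 / (LINT t|lebesgue. bump t)) * b' x)"
    by (intro continuous_on_mult continuous_on_const c)
  ultimately show ?thesis by (rule that)
qed

lemma continuous_on_eta: "continuous_on S eta"
  using eta_C1 by (metis DERIV_isCont continuous_at_imp_continuous_on)

lemma eta_has_integral: "(eta has_integral 1) {-1..1}"
proof -
  have "(bump has_integral (LINT t|lebesgue. bump t)) {-1..1}"
    by (simp add: LINT_bump continuous_on_bump integrable_continuous_real integrable_integral)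
  from has_integral_mult_right[OF this, of "1 / (LINT t|lebesgue. bump t)"]
  show ?thesis using LINT_bump_pos by (simp add: eta_def[abs_def])
qed

text \<open>Common form of \<open>eta_l\<close> (\<open>c = 0\<close>) and \<open>eta_r\<close>
  (\<open>c = 1\<close>), so that each estimate is proved once for an arbitrary centre.\<close>

definition scaled_eta :: "real \<Rightarrow> real \<Rightarrow> real \<Rightarrow> real" where
  "scaled_eta c \<rho> x = 1 / \<rho> * eta ((x - c) / \<rho>)"

lemma continuous_on_scaled_eta: "\<rho> > 0 \<Longrightarrow> continuous_on S (scaled_eta c \<rho>)"
  unfolding scaled_eta_def
  by (intro continuous_intros continuous_on_compose2[OF continuous_on_eta[of UNIV]]) auto

lemma scaled_eta_nonneg: "\<rho> > 0 \<Longrightarrow> 0 \<le> scaled_eta c \<rho> x"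
  by (simp add: scaled_eta_def eta_nonneg)

lemma scaled_eta_C1:
  assumes "\<rho> > 0"
  obtains e' where "\<And>x. (scaled_eta c \<rho> has_real_derivative e' x) (at x)" "continuous_on UNIV e'"
proof -
  obtain e' where e': "\<And>x. (eta has_real_derivative e' x) (at x)" and cont: "continuous_on UNIV e'"
    by (rule eta_C1) blast
  have "(scaled_eta c \<rho> has_real_derivative 1 / \<rho> * (e' ((x - c) / \<rho>) * (1 / \<rho>))) (at x)" for x
    unfolding scaled_eta_def using assms
    by (intro DERIV_cmult DERIV_chain2[OF e']) (auto intro!: derivative_eq_intros)
  moreover have "continuous_on UNIV (\<lambda>x. 1 / \<rho> * (e' ((x - c) / \<rho>) * (1 / \<rho>)))"
    using assms by (intro continuous_intros continuous_on_compose2[OF cont]) auto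
  ultimately show ?thesis by (rule that)
qed

lemma scaled_eta_has_integral:
  assumes "\<rho> > 0"
  shows "(scaled_eta c \<rho> has_integral 1) {c - \<rho>..c + \<rho>}"
proof -
  \<comment> \<open>This is the image set in the shape produced by
    \<open>has_integral_affinity\<close> for the substitution
    \<open>x / \<rho> - c / \<rho>\<close>; the map is just \<open>\<rho> * x + c\<close>.\<close>
  have "(\<lambda>x. (1 / (1 / \<rho>)) *\<^sub>R x + - ((1 / (1 / \<rho>)) *\<^sub>R (- c / \<rho>))) ` cbox (- 1) 1 = {c - \<rho>..c + \<rho>}"
  proof -
    have "(\<lambda>x. (1 / (1 / \<rho>)) *\<^sub>R x + - ((1 / (1 / \<rho>)) *\<^sub>R (- c / \<rho>))) = (\<lambda>x. \<rho> * x + c)"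
      using assms by (auto simp: field_simps)
    then show ?thesis
      using assms image_affinity_atLeastAtMost[of \<rho> c "-1" 1] by (simp add: add.commute)
  qed
  moreover have "((\<lambda>x. eta ((1 / \<rho>) *\<^sub>R x + (- c / \<rho>))) has_integral (1 / \<bar>1 / \<rho>\<bar> ^ DIM(real)) *\<^sub>R 1)
     ((\<lambda>x. (1 / (1 / \<rho>)) *\<^sub>R x + - ((1 / (1 / \<rho>)) *\<^sub>R (- c / \<rho>))) ` cbox (- 1) 1)"
    by (rule has_integral_affinity) (use assms eta_has_integral in auto)
  ultimately have "((\<lambda>x. eta ((x - c) / \<rho>)) has_integral \<rho>) {c - \<rho>..c + \<rho>}"
    using assms by (simp add: diff_divide_distrib)
  from has_integral_mult_right[OF this, of "1 / \<rho>"] show ?thesis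
    using assms by (simp add: scaled_eta_def[abs_def])
qed

subsection \<open>Mollified point values\<close>

text \<open>The gauge integral over the closed interval gives direct access to the fundamental
  theorem and to compactness; for continuous integrands it agrees with the Lebesgue integral over
  the open ball.\<close>

definition moll :: "real \<Rightarrow> real \<Rightarrow> (real \<Rightarrow> real) \<Rightarrow> real" where
  "moll c \<rho> g = integral {c - \<rho>..c + \<rho>} (\<lambda>x. scaled_eta c \<rho> x * g x)"

lemma moll_integrable:
  assumes "\<rho> > 0" "continuous_on {c - \<rho>..c + \<rho>} g"
  shows "(\<lambda>x. scaled_eta c \<rho> x * g x) integrable_on {c - \<rho>..c + \<rho>}"
  using assms by (intro integrable_continuous_real continuous_intros continuous_on_scaled_eta)

lemma moll_const: "\<rho> > 0 \<Longrightarrow> moll c \<rho> (\<lambda>_. a) = a"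
  unfolding moll_def
  by (rule integral_unique)
     (use has_integral_mult_left[OF scaled_eta_has_integral[of \<rho> c], of a] in simp)

lemma moll_lincomb:
  assumes "\<rho> > 0" "continuous_on {c - \<rho>..c + \<rho>} g" "continuous_on {c - \<rho>..c + \<rho>} h"
  shows "moll c \<rho> (\<lambda>x. a * g x + b * h x) = a * moll c \<rho> g + b * moll c \<rho> h"
proof -
  note I = moll_integrable[OF assms(1,2)] moll_integrable[OF assms(1,3)]
  have "((\<lambda>x. a * (scaled_eta c \<rho> x * g x) + b * (scaled_eta c \<rho> x * h x))
      has_integral a * moll c \<rho> g + b * moll c \<rho> h) {c - \<rho>..c + \<rho>}"
    unfolding moll_def
    by (intro has_integral_add has_integral_mult_right integrable_integral I)
  then show ?thesis
    unfolding moll_def by (intro integral_unique) (simp add: algebra_simps)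
qed

lemma moll_cong:
  "(\<And>x. x \<in> {c - \<rho>..c + \<rho>} \<Longrightarrow> g x = h x) \<Longrightarrow> moll c \<rho> g = moll c \<rho> h"
  unfolding moll_def by (rule integral_cong) auto

lemma moll_abs_le:
  assumes "\<rho> > 0" "continuous_on {c - \<rho>..c + \<rho>} g"
    and "\<And>x. x \<in> {c - \<rho>..c + \<rho>} \<Longrightarrow> \<bar>g x\<bar> \<le> B"
  shows "\<bar>moll c \<rho> g\<bar> \<le> B"
proof -
  have "norm (moll c \<rho> g) \<le> moll c \<rho> (\<lambda>_. B)"
    unfolding moll_def
    by (rule integral_norm_bound_integral)
       (use assms in \<open>auto intro!: moll_integrable mult_left_mono
          simp: abs_mult scaled_eta_nonneg\<close>)
  then show ?thesis using assms(1) by (simp add: moll_const)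
qed

text \<open>The weight is a probability density on an interval of radius \<open>\<rho>\<close>, so
  the mollified value differs from \<open>g c\<close> by at most the oscillation of \<open>g\<close>
  there.\<close>

lemma moll_tendsto:
  assumes r: "r > 0" and g: "continuous_on {c - r..c + r} g"
  shows "((\<lambda>\<rho>. moll c \<rho> g) \<longlongrightarrow> g c) (at 0 within {0<..r})"
proof (rule tendstoI)
  fix e :: real assume e: "e > 0"
  then obtain d where d: "d > 0"
    and dg: "\<And>x. x \<in> {c - r..c + r} \<Longrightarrow> dist x c < d \<Longrightarrow> dist (g x) (g c) < e / 2"
    using g r unfolding continuous_on_iff
    by (metis add_increasing2 atLeastAtMost_iff diff_le_eq half_gt_zero less_eq_real_def order_refl)
  have "dist (moll c \<rho> g) (g c) < e" if "\<rho> \<in> {0<..r}" "dist \<rho> 0 < d" for \<rho>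
  proof -
    have sub: "{c - \<rho>..c + \<rho>} \<subseteq> {c - r..c + r}" and pos: "\<rho> > 0" using that by auto
    have cg: "continuous_on {c - \<rho>..c + \<rho>} g" using g sub by (rule continuous_on_subset)
    \<comment> \<open>A constant is its own mollified value, so \<open>g c\<close> can be moved
      under the integral; the explicit coefficients match \<open>moll_lincomb\<close>.\<close>
    have "moll c \<rho> g - g c = moll c \<rho> (\<lambda>x. 1 * g x + (- 1) * g c)"
      using moll_lincomb[OF pos cg continuous_on_const, of 1 "-1" "g c"] pos
      by (simp add: moll_const)
    also have "\<bar>\<dots>\<bar> \<le> e / 2"
    proof (rule moll_abs_le[OF pos])
      fix x assume x: "x \<in> {c - \<rho>..c + \<rho>}"
      then have "\<bar>x - c\<bar> \<le> \<rho>" by auto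
      then have "dist x c < d" using that pos by (simp add: dist_real_def)
      then show "\<bar>1 * g x + (- 1) * g c\<bar> \<le> e / 2"
        using dg[of x] x sub by (force simp: dist_real_def)
    qed (intro continuous_intros cg)
    finally show ?thesis using e by (simp add: dist_real_def)
  qed
  then show "\<forall>\<^sub>F \<rho> in at 0 within {0<..r}. dist (moll c \<rho> g) (g c) < e"
    using d unfolding eventually_at by blast
qed

section \<open>Separation of the double average\<close>

lemma LINT_ball_eq_integral:
  fixes f :: "real \<Rightarrow> real"
  assumes "continuous_on {c - r..c + r} f"
  shows "(LINT x|lebesgue_on (ball c r). f x) = integral {c - r..c + r} f"
proof -
  have "f absolutely_integrable_on {c - r..c + r}"
    using assms by (rule absolutely_integrable_continuous_real)
  then have "f absolutely_integrable_on ball c r"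
    by (rule set_integrable_subset) (auto simp: dist_real_def)
  then have "integrable (lebesgue_on (ball c r)) f"
    by (simp add: set_integrable_def integrable_restrict_space)
  then have "(LINT x|lebesgue_on (ball c r). f x) = integral (ball c r) f"
    by (rule lebesgue_integral_eq_integral) simp
  also have "\<dots> = integral {c - r..c + r} f"
    by (simp add: ball_eq_greaterThanLessThan integral_open_interval_real)
  finally show ?thesis .
qed

text \<open>Integrating out one variable leaves the term that does not depend on it unchanged,
  because the weight in that variable has integral 1. Only values on the open balls matter for
  \<open>N\<close>, while \<open>g\<close> and \<open>h\<close> are continuous up to the
  endpoints.\<close>

lemma weighted_avg_eq_moll:
  assumes "\<rho> > 0" "continuous_on {- \<rho>..\<rho>} g" "continuous_on {1 - \<rho>..1 + \<rho>} h"
    and N: "\<And>x y. x \<in> ball 0 \<rho> \<Longrightarrow> y \<in> ball 1 \<rho> \<Longrightarrow> N x y u = a * g x + b * h y"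
  shows "weighted_avg \<rho> N u = a * moll 0 \<rho> g + b * moll 1 \<rho> h"
proof -
  have g: "continuous_on {0 - \<rho>..0 + \<rho>} g" using assms by simp
  have eta: "eta_l \<rho> x = scaled_eta 0 \<rho> x" "eta_r \<rho> x = scaled_eta 1 \<rho> x" for x
    by (auto simp: eta_l_def eta_r_def scaled_eta_def)
  note ci = continuous_intros continuous_on_scaled_eta g assms(1-3)
  have inner: "(LINT y|lebesgue_on (ball 1 \<rho>). eta_l \<rho> x * eta_r \<rho> y * N x y u)
      = scaled_eta 0 \<rho> x * (a * g x + b * moll 1 \<rho> h)" if x: "x \<in> ball 0 \<rho>" for x
  proof -
    \<comment> \<open>For the inner variable \<open>a * g x\<close> is a coefficient; the factor 1
      is the constant function that \<open>moll_lincomb\<close> combines with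
      \<open>h\<close>.\<close>
    have "(LINT y|lebesgue_on (ball 1 \<rho>). eta_l \<rho> x * eta_r \<rho> y * N x y u)
        = (LINT y|lebesgue_on (ball 1 \<rho>).
             scaled_eta 0 \<rho> x * (scaled_eta 1 \<rho> y * ((a * g x) * 1 + b * h y)))"
      by (rule Bochner_Integration.integral_cong) (simp_all add: eta N[OF x])
    also have "\<dots> = scaled_eta 0 \<rho> x * moll 1 \<rho> (\<lambda>y. (a * g x) * 1 + b * h y)"
      by (subst LINT_ball_eq_integral) (auto intro!: ci simp: moll_def)
    also have "\<dots> = scaled_eta 0 \<rho> x * (a * g x + b * moll 1 \<rho> h)"
      using assms by (subst moll_lincomb) (auto simp: moll_const)
    finally show ?thesis .
  qed
  have "weighted_avg \<rho> N u = (LINT x|lebesgue_on (ball 0 \<rho>).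
      scaled_eta 0 \<rho> x * (a * g x + b * moll 1 \<rho> h))"
    unfolding weighted_avg_def
    by (rule Bochner_Integration.integral_cong) (auto simp: inner)
  also have "\<dots> = moll 0 \<rho> (\<lambda>x. a * g x + b * moll 1 \<rho> h)"
    by (subst LINT_ball_eq_integral) (auto intro!: ci simp: moll_def)
  also have "\<dots> = a * moll 0 \<rho> g + b * moll 1 \<rho> h"
    using assms g by (subst moll_lincomb) (auto simp: moll_const)
  finally show ?thesis .
qed

section \<open>Bounds in the L1 norm\<close>

lemma L1_bound_integral_mult:
  fixes w :: "real \<Rightarrow> real"
  assumes w: "continuous_on {p..q} w" and sub: "{p..q} \<subseteq> {a..b}"
  obtains C where "C \<ge> 0" "\<And>g. continuous_on {a..b} g \<Longrightarrow>
    \<bar>integral {p..q} (\<lambda>x. w x * g x)\<bar> \<le> C * integral {a..b} (\<lambda>x. \<bar>g x\<bar>)"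
proof -
  \<comment> \<open>The bound comes from the weight alone, so the constant is the same for all
    \<open>g\<close>.\<close>
  have "bounded (w ` {p..q})"
    using w by (intro compact_imp_bounded compact_continuous_image) auto
  then obtain C where C: "C > 0" "\<And>x. x \<in> {p..q} \<Longrightarrow> \<bar>w x\<bar> \<le> C"
    unfolding bounded_pos by auto
  have "\<bar>integral {p..q} (\<lambda>x. w x * g x)\<bar> \<le> C * integral {a..b} (\<lambda>x. \<bar>g x\<bar>)"
    if g: "continuous_on {a..b} g" for g
  proof -
    have g': "continuous_on {p..q} g" using g sub by (rule continuous_on_subset)
    have "norm (integral {p..q} (\<lambda>x. w x * g x)) \<le> integral {p..q} (\<lambda>x. C * \<bar>g x\<bar>)"
      by (rule integral_norm_bound_integral)
         (use C in \<open>auto intro!: integrable_continuous_real continuous_intros w g' mult_right_mono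
            simp: abs_mult\<close>)
    also have "\<dots> \<le> integral {a..b} (\<lambda>x. C * \<bar>g x\<bar>)"
      by (rule integral_subset_le)
         (use C sub in \<open>auto intro!: integrable_continuous_real continuous_intros g g'\<close>)
    finally show ?thesis by simp
  qed
  with C show ?thesis by (intro that[of C]) auto
qed

lemma moll_L1_bound:
  assumes "\<rho> > 0" "{c - \<rho>..c + \<rho>} \<subseteq> {a..b}"
  obtains C where "C \<ge> 0" "\<And>g. continuous_on {a..b} g \<Longrightarrow>
    \<bar>moll c \<rho> g\<bar> \<le> C * integral {a..b} (\<lambda>x. \<bar>g x\<bar>)"
  unfolding moll_def
  by (rule L1_bound_integral_mult[OF continuous_on_scaled_eta[OF assms(1)] assms(2)]) blast

text \<open>The product rule moves the derivative onto the weight, whose derivative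
  \<open>e'\<close> is again a continuous weight independent of \<open>u\<close>, so
  \<open>L1_bound_integral_mult\<close> applies to it.\<close>

lemma moll_deriv_L1_bound:
  assumes \<rho>: "\<rho> > 0" and sub: "{c - \<rho>..c + \<rho>} \<subseteq> {a..b}"
  obtains C where "C \<ge> 0" "\<And>u u'. continuous_on {a..b} u' \<Longrightarrow>
    (\<And>x. x \<in> {a..b} \<Longrightarrow> (u has_real_derivative u' x) (at x)) \<Longrightarrow>
    \<bar>moll c \<rho> u'\<bar> \<le> C * integral {a..b} (\<lambda>x. \<bar>u x\<bar>)"
proof -
  let ?I = "{c - \<rho>..c + \<rho>}"
  obtain e' where e': "\<And>x. (scaled_eta c \<rho> has_real_derivative e' x) (at x)"
    and ce': "continuous_on UNIV e'"
    using \<rho> by (rule scaled_eta_C1) blast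
  have ce'': "continuous_on ?I e'" using ce' by (rule continuous_on_subset) simp
  obtain C where C: "C \<ge> 0" "\<And>g. continuous_on {a..b} g \<Longrightarrow>
      \<bar>integral ?I (\<lambda>x. e' x * g x)\<bar> \<le> C * integral {a..b} (\<lambda>x. \<bar>g x\<bar>)"
    using ce'' sub by (rule L1_bound_integral_mult) blast
  have "\<bar>moll c \<rho> u'\<bar> \<le> C * integral {a..b} (\<lambda>x. \<bar>u x\<bar>)"
    if u': "continuous_on {a..b} u'"
      and u: "\<And>x. x \<in> {a..b} \<Longrightarrow> (u has_real_derivative u' x) (at x)" for u u'
  proof -
    have cu: "continuous_on {a..b} u"
      using u by (meson DERIV_isCont continuous_at_imp_continuous_on)
    have cu2: "continuous_on ?I u" and cu'2: "continuous_on ?I u'"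
      using continuous_on_subset[OF _ sub] cu u' by blast+
    have "((\<lambda>x. scaled_eta c \<rho> x * u' x + e' x * u x) has_integral
        scaled_eta c \<rho> (c + \<rho>) * u (c + \<rho>) - scaled_eta c \<rho> (c - \<rho>) * u (c - \<rho>)) ?I"
    proof (rule fundamental_theorem_of_calculus)
      fix x assume "x \<in> ?I"
      then have "(u has_real_derivative u' x) (at x)" using u sub by blast
      then have "((\<lambda>x. scaled_eta c \<rho> x * u x) has_real_derivative
          scaled_eta c \<rho> x * u' x + e' x * u x) (at x within ?I)"
        by (rule DERIV_mult'[OF has_field_derivative_at_within[OF e'] has_field_derivative_at_within])
      then show "((\<lambda>x. scaled_eta c \<rho> x * u x) has_vector_derivative
          scaled_eta c \<rho> x * u' x + e' x * u x) (at x within ?I)"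
        by (simp add: has_real_derivative_iff_has_vector_derivative)
    qed (use \<rho> in auto)
    \<comment> \<open>The boundary terms vanish: the endpoints correspond to -1 and 1, where the
      strict inequality in \<open>bump\<close> already gives 0.\<close>
    moreover have "scaled_eta c \<rho> (c + \<rho>) = 0" "scaled_eta c \<rho> (c - \<rho>) = 0"
      using \<rho> by (auto simp: scaled_eta_def eta_def bump_def)
    moreover have "integral ?I (\<lambda>x. scaled_eta c \<rho> x * u' x + e' x * u x)
        = moll c \<rho> u' + integral ?I (\<lambda>x. e' x * u x)"
      unfolding moll_def
      by (rule Henstock_Kurzweil_Integration.integral_add)
         (auto intro!: integrable_continuous_real continuous_intros continuous_on_scaled_eta
            \<rho> cu2 cu'2 ce'')
    ultimately have "moll c \<rho> u' = - integral ?I (\<lambda>x. e' x * u x)"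
      by (auto dest!: integral_unique)
    then show ?thesis using C(2)[OF cu] by simp
  qed
  with C(1) show ?thesis by (rule that)
qed

subsection \<open>Extension by continuity\<close>

text \<open>It suffices that \<open>F\<close> is Lipschitz at the single point \<open>p\<close> in
  the L1 norm; linearity of \<open>F\<close> does not enter. Convergence along every admissible
  sequence gives existence of the common limit.\<close>

lemma L2_extension_eq:
  assumes ab: "a \<le> b" and cont: "\<And>w. w \<in> D \<Longrightarrow> continuous_on {a..b} w" and p: "p \<in> D"
    and C: "C \<ge> 0" "\<And>w. w \<in> D \<Longrightarrow> \<bar>F w - F p\<bar> \<le> C * integral {a..b} (\<lambda>x. \<bar>w x - p x\<bar>)"
  shows "L2_extension {a..b} D F p = F p"
proof -
  have LINT: "(LINT x|lebesgue_on {a..b}. (w x - p x)\<^sup>2) = integral {a..b} (\<lambda>x. (w x - p x)\<^sup>2)"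
    if "w \<in> D" for w
    by (intro lebesgue_integral_eq_integral continuous_imp_integrable_real continuous_intros
        cont[OF p] cont[OF that]) auto
  have conv: "(\<lambda>n. F (w n)) \<longlonglongrightarrow> F p"
    if w: "\<forall>n. w n \<in> D" and lim: "(\<lambda>n. LINT x|lebesgue_on {a..b}. (w n x - p x)\<^sup>2) \<longlonglongrightarrow> 0"
    for w :: "nat \<Rightarrow> real \<Rightarrow> real"
  proof -
    let ?s = "\<lambda>n. integral {a..b} (\<lambda>x. (w n x - p x)\<^sup>2)"
    let ?t = "\<lambda>n. integral {a..b} (\<lambda>x. \<bar>w n x - p x\<bar>)"
    have cw: "continuous_on {a..b} (w n)" for n using w cont by blast
    \<comment> \<open>\<open>d \<le> e + d\<^sup>2 / e\<close> turns convergence in \<open>L\<^sup>2\<close> into convergence in \<open>L\<^sup>1\<close>.\<close>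
    have L1: "?t n \<le> e * (b - a) + ?s n / e" if "e > 0" for e n
    proof -
      have "?t n \<le> integral {a..b} (\<lambda>x. e + (w n x - p x)\<^sup>2 / e)"
      proof (rule integral_le)
        fix x
        show "\<bar>w n x - p x\<bar> \<le> e + (w n x - p x)\<^sup>2 / e"
        proof -
          let ?d = "\<bar>w n x - p x\<bar>"
          \<comment> \<open>The right-hand side expands to
            \<open>e\<^sup>2 - e * ?d + ?d\<^sup>2\<close>, which is the claim multiplied by
            \<open>e\<close>.\<close>
          have "0 \<le> (e - ?d)\<^sup>2 + e * ?d" using \<open>e > 0\<close> by (intro add_nonneg_nonneg) auto
          then have "e * ?d \<le> e * e + ?d\<^sup>2"
            by (simp add: power2_eq_square algebra_simps)
          then show ?thesis using \<open>e > 0\<close> by (simp add: field_simps)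
        qed
      qed (use \<open>e > 0\<close> in \<open>auto intro!: integrable_continuous_real continuous_intros cw cont[OF p]\<close>)
      also have "\<dots> = e * (b - a) + ?s n / e"
      proof (rule integral_unique)
        have "((\<lambda>x. (w n x - p x)\<^sup>2) has_integral ?s n) {a..b}"
          by (intro integrable_integral integrable_continuous_real continuous_intros cw cont[OF p])
        from has_integral_add[OF has_integral_const_real[of e a b] has_integral_divide[OF this, of e]]
        show "((\<lambda>x. e + (w n x - p x)\<^sup>2 / e) has_integral e * (b - a) + ?s n / e) {a..b}"
          using ab by (simp add: mult.commute)
      qed
      finally show ?thesis .
    qed
    have "?t \<longlonglongrightarrow> 0"
    proof (rule LIMSEQ_I)
      fix r :: real assume r: "r > 0"
      \<comment> \<open>Once \<open>?s n < e * e\<close>, the bound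
        \<open>e * (b - a) + ?s n / e\<close> is below \<open>e * (b - a + 1) = r\<close>. The added
        1 absorbs the second term and keeps the denominator positive when
        \<open>a = b\<close>.\<close>
      define e where "e = r / (b - a + 1)"
      have e: "e > 0" using r ab by (simp add: e_def)
      have "?s \<longlonglongrightarrow> 0" using lim LINT w by simp
      from LIMSEQ_D[OF this mult_pos_pos[OF e e]]
      obtain N where N: "\<And>n. n \<ge> N \<Longrightarrow> norm (?s n - 0) < e * e" by blast
      have "norm (?t n - 0) < r" if "n \<ge> N" for n
      proof -
        have "0 \<le> ?t n" by (rule Henstock_Kurzweil_Integration.integral_nonneg)
            (auto intro!: integrable_continuous_real continuous_intros cw cont[OF p])
        moreover have "?s n / e < e"
          using le_less_trans[OF abs_ge_self, of "?s n" "e * e"] N[OF that] e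
          by (simp add: pos_divide_less_eq)
        moreover have "e * (b - a + 1) = r"
          using ab by (simp add: e_def)
        then have "e * (b - a) + e = r" by (simp add: distrib_left)
        ultimately show ?thesis using L1[OF e, of n] by simp
      qed
      then show "\<exists>N. \<forall>n\<ge>N. norm (?t n - 0) < r" by blast
    qed
    then have "(\<lambda>n. C * ?t n) \<longlonglongrightarrow> 0" by (rule tendsto_mult_right_zero)
    then have "(\<lambda>n. F (w n) - F p) \<longlonglongrightarrow> 0"
      by (rule Lim_null_comparison[rotated]) (use C(2) w in simp)
    then show ?thesis by (simp add: LIM_zero_iff)
  qed
  have "p \<in> borel_measurable (lebesgue_on {a..b})"
    using cont[OF p] by (intro continuous_imp_measurable_on_sets_lebesgue) auto
  moreover have "integrable (lebesgue_on {a..b}) (\<lambda>x. (p x)\<^sup>2)"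
    by (intro continuous_imp_integrable_real continuous_intros cont[OF p])
  ultimately have "p \<in> L2_on {a..b}" by (simp add: L2_on_def)
  moreover have "(THE c. \<forall>w :: nat \<Rightarrow> real \<Rightarrow> real. (\<forall>n. w n \<in> D) \<longrightarrow>
       (\<lambda>n. LINT x|lebesgue_on {a..b}. (w n x - p x)^2) \<longlonglongrightarrow> 0 \<longrightarrow> (\<lambda>n. F (w n)) \<longlonglongrightarrow> c) = F p"
  proof (rule the_equality)
    fix c assume "\<forall>w :: nat \<Rightarrow> real \<Rightarrow> real. (\<forall>n. w n \<in> D) \<longrightarrow>
       (\<lambda>n. LINT x|lebesgue_on {a..b}. (w n x - p x)^2) \<longlonglongrightarrow> 0 \<longrightarrow> (\<lambda>n. F (w n)) \<longlonglongrightarrow> c"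
    \<comment> \<open>Uniqueness: the constant sequence \<open>p\<close> is admissible and forces
      the limit to be \<open>F p\<close>.\<close>
    from this[rule_format, of "\<lambda>_. p"] p show "c = F p"
      by (simp add: LIMSEQ_const_iff)
  qed (use conv in blast)
  ultimately show ?thesis by (simp add: L2_extension_def)
qed

subsection \<open>0-forms\<close>

text \<open>\<open>C1_differentiable_on\<close> demands a two-sided derivative even at endpoints of
  \<open>S\<close>, so its witness is determined and equals \<open>deriv u\<close>, the operator
  used in \<open>pert_node0\<close>.\<close>

lemma C1_differentiable_on_deriv:
  assumes "u C1_differentiable_on S"
  shows "x \<in> S \<Longrightarrow> (u has_real_derivative deriv u x) (at x)" "continuous_on S (deriv u)" "continuous_on S u"
proof -
  obtain D where D: "\<And>x. x \<in> S \<Longrightarrow> (u has_real_derivative D x) (at x)" "continuous_on S D"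
    using assms
    by (auto simp: C1_differentiable_on_def simp flip: has_real_derivative_iff_has_vector_derivative)
  have eq: "deriv u x = D x" if "x \<in> S" for x using D(1)[OF that] by (rule DERIV_imp_deriv)
  show "x \<in> S \<Longrightarrow> (u has_real_derivative deriv u x) (at x)" using D(1) eq by simp
  show "continuous_on S (deriv u)" using D(2) eq by (simp cong: continuous_on_cong)
  show "continuous_on S u" using D(1) by (meson DERIV_isCont continuous_at_imp_continuous_on)
qed

lemma C1_differentiable_on_lincomb:
  fixes u v :: "real \<Rightarrow> real"
  assumes "u C1_differentiable_on S" "v C1_differentiable_on S"
  shows "(\<lambda>x. a * u x + b * v x) C1_differentiable_on S"
    and "x \<in> S \<Longrightarrow> deriv (\<lambda>x. a * u x + b * v x) x = a * deriv u x + b * deriv v x"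
proof -
  show "(\<lambda>x. a * u x + b * v x) C1_differentiable_on S"
    using assms by (intro C1_differentiable_on_add C1_differentiable_on_mult
        C1_differentiable_on_const)
  assume "x \<in> S"
  then show "deriv (\<lambda>x. a * u x + b * v x) x = a * deriv u x + b * deriv v x"
    by (intro DERIV_imp_deriv DERIV_add DERIV_cmult C1_differentiable_on_deriv(1)[OF assms(1)]
        C1_differentiable_on_deriv(1)[OF assms(2)])
qed

lemma I_ext_subset:
  assumes "0 < \<rho>" "\<rho> \<le> 1 / 3"
  shows "{- \<rho>..\<rho>} \<subseteq> I_ext \<rho>" "{1 - \<rho>..1 + \<rho>} \<subseteq> I_ext \<rho>"
  using assms by (auto simp: I_ext_def)

lemma moll_tendsto_I_ext:
  assumes g: "continuous_on (I_ext (1 / 3)) g" and c: "c = 0 \<or> c = 1"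
  shows "((\<lambda>\<rho>. moll c \<rho> g) \<longlongrightarrow> g c) (at 0 within {0<..1/3})"
proof (rule moll_tendsto)
  have "{c - 1/3..c + 1/3} \<subseteq> I_ext (1 / 3)"
    using c by (elim disjE) (simp_all add: I_ext_def)
  with g show "continuous_on {c - 1/3..c + 1/3} g" by (rule continuous_on_subset)
qed simp

text \<open>Both claims rest on one identification, \<open>eq\<close>, of the extended functional
  with the classical average on C1 functions, and are therefore proved together.\<close>

lemma
  shows weighted_node0_lincomb: "\<And>\<rho> u v i a b. 0 < \<rho> \<Longrightarrow> \<rho> \<le> 1 / 3 \<Longrightarrow>
      u C1_differentiable_on I_ext \<rho> \<Longrightarrow> v C1_differentiable_on I_ext \<rho> \<Longrightarrow>
      weighted_node0 \<rho> i (\<lambda>x. a * u x + b * v x) = a * weighted_node0 \<rho> i u + b * weighted_node0 \<rho> i v"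
    and weighted_node0_tendsto: "\<And>u i. u C1_differentiable_on I_ext (1 / 3) \<Longrightarrow>
      ((\<lambda>\<rho>. weighted_node0 \<rho> i u) \<longlongrightarrow> node0 i u) (at 0 within {0<..1/3})"
proof -
  have avg: "weighted_avg \<rho> (pert_node0 i) u =
    (if i = 1 then moll 0 \<rho> (deriv u) else if i = 2 then moll 1 \<rho> (deriv u)
     else if i = 3 then moll 1 \<rho> u - moll 0 \<rho> u else moll 1 \<rho> u + moll 0 \<rho> u)"
    if \<rho>: "0 < \<rho>" "\<rho> \<le> 1 / 3" and u: "u C1_differentiable_on I_ext \<rho>" for \<rho> u i
  proof -
    note sub = I_ext_subset[OF \<rho>]
    note c = C1_differentiable_on_deriv(2,3)[OF u]
    note cl = c[THEN continuous_on_subset, OF sub(1)] and cr = c[THEN continuous_on_subset, OF sub(2)]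
    \<comment> \<open>The coefficients (a, b) of the left and right values are (1, 0), (0, 1), (-1,
      1) and (1, 1); the values are those of \<open>deriv u\<close> in the first two cases and of
      \<open>u\<close> in the others.\<close>
    consider "i = 1" | "i = 2" | "i = 3" | "i \<notin> {1, 2, 3}" by blast
    then show ?thesis
    proof cases
      case 1
      then show ?thesis
        using weighted_avg_eq_moll[OF \<rho>(1) cl(1) cr(1), of "pert_node0 i" u 1 0]
        by (simp add: pert_node0_def)
    next
      case 2
      then show ?thesis
        using weighted_avg_eq_moll[OF \<rho>(1) cl(1) cr(1), of "pert_node0 i" u 0 1]
        by (simp add: pert_node0_def)
    next
      case 3
      then show ?thesis
        using weighted_avg_eq_moll[OF \<rho>(1) cl(2) cr(2), of "pert_node0 i" u "-1" 1]
        by (simp add: pert_node0_def)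
    next
      case 4
      then show ?thesis
        using weighted_avg_eq_moll[OF \<rho>(1) cl(2) cr(2), of "pert_node0 i" u 1 1]
        by (simp add: pert_node0_def)
    qed
  qed
  have avg_lincomb: "weighted_avg \<rho> (pert_node0 i) (\<lambda>x. a * u x + b * v x)
      = a * weighted_avg \<rho> (pert_node0 i) u + b * weighted_avg \<rho> (pert_node0 i) v"
    if \<rho>: "0 < \<rho>" "\<rho> \<le> 1 / 3"
      and u: "u C1_differentiable_on I_ext \<rho>" and v: "v C1_differentiable_on I_ext \<rho>"
    for \<rho> u v i a b
  proof -
    note sub = I_ext_subset[OF \<rho>]
    \<comment> \<open>The derivative of the combination is known only on
      \<open>I_ext \<rho>\<close>, so the two functions are exchanged under the integral and not
      globally.\<close>
    have d: "moll c \<rho> (deriv (\<lambda>x. a * u x + b * v x)) = moll c \<rho> (\<lambda>x. a * deriv u x + b * deriv v x)"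
      if "{c - \<rho>..c + \<rho>} \<subseteq> I_ext \<rho>" for c
      by (rule moll_cong, rule C1_differentiable_on_lincomb(2)[OF u v]) (use that in blast)
    have cont: "continuous_on {- \<rho>..\<rho>} w" "continuous_on {1 - \<rho>..1 + \<rho>} w"
      if "continuous_on (I_ext \<rho>) w" for w :: "real \<Rightarrow> real"
      using that sub by (auto intro: continuous_on_subset)
    note C = C1_differentiable_on_deriv(2,3)[OF u] C1_differentiable_on_deriv(2,3)[OF v]
    show ?thesis
      unfolding avg[OF \<rho> u] avg[OF \<rho> v]
        avg[OF \<rho> C1_differentiable_on_lincomb(1)[OF u v]]
      by (simp add: d sub moll_lincomb cont C \<rho>) (simp add: algebra_simps)
  qed
  have bound: "\<exists>C\<ge>0. \<forall>u. u C1_differentiable_on I_ext \<rho> \<longrightarrow>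
      \<bar>weighted_avg \<rho> (pert_node0 i) u\<bar> \<le> C * integral (I_ext \<rho>) (\<lambda>x. \<bar>u x\<bar>)"
    if \<rho>: "0 < \<rho>" "\<rho> \<le> 1 / 3" for \<rho> i
  proof -
    have sub: "{0 - \<rho>..0 + \<rho>} \<subseteq> {- \<rho>..1 + \<rho>}" "{1 - \<rho>..1 + \<rho>} \<subseteq> {- \<rho>..1 + \<rho>}"
      using \<rho> by auto
    obtain C1 where C1: "0 \<le> C1" "\<And>g. continuous_on (I_ext \<rho>) g \<Longrightarrow>
        \<bar>moll 0 \<rho> g\<bar> \<le> C1 * integral (I_ext \<rho>) (\<lambda>x. \<bar>g x\<bar>)"
      unfolding I_ext_def by (rule moll_L1_bound[OF \<rho>(1) sub(1)]) blast
    obtain C2 where C2: "0 \<le> C2" "\<And>g. continuous_on (I_ext \<rho>) g \<Longrightarrow>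
        \<bar>moll 1 \<rho> g\<bar> \<le> C2 * integral (I_ext \<rho>) (\<lambda>x. \<bar>g x\<bar>)"
      unfolding I_ext_def by (rule moll_L1_bound[OF \<rho>(1) sub(2)]) blast
    obtain C3 where C3: "0 \<le> C3" "\<And>u u'. continuous_on (I_ext \<rho>) u' \<Longrightarrow>
      (\<And>x. x \<in> I_ext \<rho> \<Longrightarrow> (u has_real_derivative u' x) (at x)) \<Longrightarrow>
        \<bar>moll 0 \<rho> u'\<bar> \<le> C3 * integral (I_ext \<rho>) (\<lambda>x. \<bar>u x\<bar>)"
      unfolding I_ext_def by (rule moll_deriv_L1_bound[OF \<rho>(1) sub(1)]) blast
    obtain C4 where C4: "0 \<le> C4" "\<And>u u'. continuous_on (I_ext \<rho>) u' \<Longrightarrow>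
      (\<And>x. x \<in> I_ext \<rho> \<Longrightarrow> (u has_real_derivative u' x) (at x)) \<Longrightarrow>
        \<bar>moll 1 \<rho> u'\<bar> \<le> C4 * integral (I_ext \<rho>) (\<lambda>x. \<bar>u x\<bar>)"
      unfolding I_ext_def by (rule moll_deriv_L1_bound[OF \<rho>(1) sub(2)]) blast
    \<comment> \<open>\<open>C1\<close> and \<open>C2\<close> control point values,
      \<open>C3\<close> and \<open>C4\<close> derivatives; their sum serves all node functionals at
      once.\<close>
    have "\<bar>weighted_avg \<rho> (pert_node0 i) u\<bar> \<le> (C1 + C2 + C3 + C4) * integral (I_ext \<rho>) (\<lambda>x. \<bar>u x\<bar>)"
      if u: "u C1_differentiable_on I_ext \<rho>" for u
    proof -
      let ?J = "integral (I_ext \<rho>) (\<lambda>x. \<bar>u x\<bar>)"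
      let ?R = "(C1 + C2 + C3 + C4) * ?J"
      note U = C1_differentiable_on_deriv[OF u]
      have "0 \<le> ?J" using U(3) unfolding I_ext_def
        by (intro Henstock_Kurzweil_Integration.integral_nonneg integrable_continuous_real
            continuous_intros) auto
      then have "0 \<le> C1 * ?J" "0 \<le> C2 * ?J" "0 \<le> C3 * ?J" "0 \<le> C4 * ?J"
        using C1(1) C2(1) C3(1) C4(1) by auto
      then have R: "C2 * ?J + C1 * ?J \<le> ?R" "C3 * ?J \<le> ?R" "C4 * ?J \<le> ?R"
        by (simp_all add: distrib_right)
      have "\<bar>moll 0 \<rho> (deriv u)\<bar> \<le> ?R"
        using C3(2)[OF U(2) U(1)] R(2) by (rule order_trans)
      moreover have "\<bar>moll 1 \<rho> (deriv u)\<bar> \<le> ?R"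
        using C4(2)[OF U(2) U(1)] R(3) by (rule order_trans)
      moreover have m: "\<bar>moll 1 \<rho> u\<bar> + \<bar>moll 0 \<rho> u\<bar> \<le> ?R"
        using add_mono[OF C2(2)[OF U(3)] C1(2)[OF U(3)]] R(1) by (rule order_trans)
      ultimately show ?thesis
        unfolding avg[OF \<rho> u]
        using order_trans[OF abs_triangle_ineq4 m] order_trans[OF abs_triangle_ineq m]
        by (simp only: split: if_split) blast
    qed
    with C1 C2 C3 C4 show ?thesis by (intro exI[of _ "C1 + C2 + C3 + C4"]) auto
  qed
  have eq: "weighted_node0 \<rho> i u = weighted_avg \<rho> (pert_node0 i) u"
    if \<rho>: "0 < \<rho>" "\<rho> \<le> 1 / 3" and u: "u C1_differentiable_on I_ext \<rho>" for \<rho> u i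
  proof -
    obtain C where C: "0 \<le> C" "\<And>u. u C1_differentiable_on I_ext \<rho> \<Longrightarrow>
      \<bar>weighted_avg \<rho> (pert_node0 i) u\<bar> \<le> C * integral (I_ext \<rho>) (\<lambda>x. \<bar>u x\<bar>)"
      using bound[OF \<rho>] by blast
    show ?thesis
      unfolding weighted_node0_def I_ext_def
    proof (rule L2_extension_eq, fold I_ext_def)
      fix w :: "real \<Rightarrow> real" assume "w \<in> {u. u C1_differentiable_on I_ext \<rho>}"
      then have w: "w C1_differentiable_on I_ext \<rho>" by simp
      \<comment> \<open>By linearity the bound applied to \<open>1 * w + (- 1) * u\<close> is the
        Lipschitz estimate at \<open>u\<close>.\<close>
      show "\<bar>weighted_avg \<rho> (pert_node0 i) w - weighted_avg \<rho> (pert_node0 i) u\<bar>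
          \<le> C * integral (I_ext \<rho>) (\<lambda>x. \<bar>w x - u x\<bar>)"
        using C(2)[OF C1_differentiable_on_lincomb(1)[OF w u, of 1 "-1"]]
          avg_lincomb[OF \<rho> w u, of i 1 "-1"] by simp
      show "continuous_on (I_ext \<rho>) w" using w by (rule C1_differentiable_on_deriv)
    qed (use \<rho> C u in auto)
  qed
  show "weighted_node0 \<rho> i (\<lambda>x. a * u x + b * v x)
      = a * weighted_node0 \<rho> i u + b * weighted_node0 \<rho> i v"
    if "0 < \<rho>" "\<rho> \<le> 1 / 3" "u C1_differentiable_on I_ext \<rho>" "v C1_differentiable_on I_ext \<rho>"
    for \<rho> u v i a b
    using that by (simp add: eq avg_lincomb C1_differentiable_on_lincomb)
  show "((\<lambda>\<rho>. weighted_node0 \<rho> i u) \<longlongrightarrow> node0 i u) (at 0 within {0<..1/3})"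
    if u: "u C1_differentiable_on I_ext (1 / 3)" for u i
  proof (rule Lim_transform_eventually)
    let ?m = "\<lambda>\<rho>. if i = 1 then moll 0 \<rho> (deriv u) else if i = 2 then moll 1 \<rho> (deriv u)
       else if i = 3 then moll 1 \<rho> u - moll 0 \<rho> u else moll 1 \<rho> u + moll 0 \<rho> u"
    note U = C1_differentiable_on_deriv[OF u]
    \<comment> \<open>\<open>node0\<close> differentiates within [0,1], hence one-sidedly at the
      nodes; \<open>u\<close> is differentiable in the two-sided sense there, so both notions
      agree.\<close>
    have "vector_derivative u (at x within {0..1}) = deriv u x" if "x \<in> {0..1}" for x
    proof (rule vector_derivative_at_within_ivl)
      show "(u has_vector_derivative deriv u x) (at x)"
        unfolding has_real_derivative_iff_has_vector_derivative[symmetric]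
        by (rule U(1)) (use that in \<open>simp add: I_ext_def\<close>)
    qed (use that in simp_all)
    from this[of 0] this[of 1]
    show "(?m \<longlongrightarrow> node0 i u) (at 0 within {0<..1/3})"
      by (simp add: node0_def tendsto_diff tendsto_add moll_tendsto_I_ext U(2,3))
    have "?m \<rho> = weighted_node0 \<rho> i u" if "0 < \<rho>" "\<rho> \<le> 1 / 3" for \<rho>
    proof -
      have "u C1_differentiable_on I_ext \<rho>"
        using that by (intro C1_differentiable_on_subset[OF u]) (simp add: I_ext_def)
      with that show ?thesis by (simp add: eq avg)
    qed
    then show "\<forall>\<^sub>F \<rho> in at 0 within {0<..1/3}. ?m \<rho> = weighted_node0 \<rho> i u"
      by (simp add: eventually_at_filter)
  qed
qed

subsection \<open>1-forms\<close>

text \<open>The antiderivative vanishes at the left endpoint, hence is bounded by the L1 norm of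
  \<open>v\<close>. This turns bounds on point values of \<open>V\<close> into L1 bounds on
  \<open>v\<close>.\<close>

lemma I_ext_antiderivative:
  assumes "continuous_on (I_ext \<rho>) (v :: real \<Rightarrow> real)"
  obtains V where "\<And>x. x \<in> I_ext \<rho> \<Longrightarrow> (V has_real_derivative v x) (at x within I_ext \<rho>)"
    "\<And>x. x \<in> I_ext \<rho> \<Longrightarrow> \<bar>V x\<bar> \<le> integral (I_ext \<rho>) (\<lambda>x. \<bar>v x\<bar>)"
proof (rule that)
  let ?V = "\<lambda>x. integral {- \<rho>..x} v"
  fix x assume x: "x \<in> I_ext \<rho>"
  show "(?V has_real_derivative v x) (at x within I_ext \<rho>)"
    using integral_has_real_derivative assms x unfolding I_ext_def by blast
  have sub: "{- \<rho>..x} \<subseteq> {- \<rho>..1 + \<rho>}" using x by (auto simp: I_ext_def)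
  have c: "continuous_on {- \<rho>..1 + \<rho>} v" using assms by (simp add: I_ext_def)
  have c': "continuous_on {- \<rho>..x} v" using c sub by (rule continuous_on_subset)
  have "norm (?V x) \<le> integral {- \<rho>..x} (\<lambda>x. \<bar>v x\<bar>)"
    by (rule integral_norm_bound_integral)
       (auto intro!: integrable_continuous_real continuous_intros c')
  also have "\<dots> \<le> integral (I_ext \<rho>) (\<lambda>x. \<bar>v x\<bar>)"
    unfolding I_ext_def
    by (rule integral_subset_le)
       (use sub in \<open>auto intro!: integrable_continuous_real continuous_intros c c'\<close>)
  finally show "\<bar>?V x\<bar> \<le> integral (I_ext \<rho>) (\<lambda>x. \<bar>v x\<bar>)" by simp
qed

text \<open>An antiderivative \<open>V\<close> puts the integral functional into the separated form
  \<open>V yr - V yl\<close>. The formula \<open>avg\<close> admits any antiderivative, so that each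
  step below can pick a convenient one.\<close>

lemma
  shows weighted_node1_lincomb: "\<And>\<rho> u v i a b. 0 < \<rho> \<Longrightarrow> \<rho> \<le> 1 / 3 \<Longrightarrow>
      continuous_on (I_ext \<rho>) u \<Longrightarrow> continuous_on (I_ext \<rho>) v \<Longrightarrow>
      weighted_node1 \<rho> i (\<lambda>x. a * u x + b * v x) = a * weighted_node1 \<rho> i u + b * weighted_node1 \<rho> i v"
    and weighted_node1_tendsto: "\<And>v i. continuous_on (I_ext (1 / 3)) v \<Longrightarrow>
      ((\<lambda>\<rho>. weighted_node1 \<rho> i v) \<longlongrightarrow> node1 i v) (at 0 within {0<..1/3})"
proof -
  have avg: "weighted_avg \<rho> (pert_node1 i) v =
    (if i = 1 then moll 0 \<rho> v else if i = 2 then moll 1 \<rho> v else moll 1 \<rho> V - moll 0 \<rho> V)"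
    if \<rho>: "0 < \<rho>" "\<rho> \<le> 1 / 3" and v: "continuous_on (I_ext \<rho>) v"
      and V: "\<And>x. x \<in> I_ext \<rho> \<Longrightarrow> (V has_real_derivative v x) (at x within I_ext \<rho>)"
    for \<rho> v V i
  proof -
    note sub = I_ext_subset[OF \<rho>]
    have cV: "continuous_on (I_ext \<rho>) V" using V by (rule DERIV_continuous_on)
    note cl = v[THEN continuous_on_subset, OF sub(1)] cV[THEN continuous_on_subset, OF sub(1)]
      and cr = v[THEN continuous_on_subset, OF sub(2)] cV[THEN continuous_on_subset, OF sub(2)]
    consider "i = 1" | "i = 2" | "i \<notin> {1, 2}" by blast
    then show ?thesis
    proof cases
      case 1
      then show ?thesis
        using weighted_avg_eq_moll[OF \<rho>(1) cl(1) cr(1), of "pert_node1 i" v 1 0]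
        by (simp add: pert_node1_def)
    next
      case 2
      then show ?thesis
        using weighted_avg_eq_moll[OF \<rho>(1) cl(1) cr(1), of "pert_node1 i" v 0 1]
        by (simp add: pert_node1_def)
    next
      case 3
      have "(LINT t|lebesgue_on {x..y}. v t) = V y - V x" if "x \<in> ball 0 \<rho>" "y \<in> ball 1 \<rho>" for x y
      proof -
        \<comment> \<open>Here \<open>\<rho> \<le> 1/3\<close> separates the balls:
          \<open>x < 1/3 < 2/3 < y\<close>.\<close>
        from that \<rho> have xy: "x \<le> y" "{x..y} \<subseteq> I_ext \<rho>" by (auto simp: dist_real_def I_ext_def)
        have "(LINT t|lebesgue_on {x..y}. v t) = integral {x..y} v"
          by (intro lebesgue_integral_eq_integral continuous_imp_integrable_real
              continuous_on_subset[OF v xy(2)]) auto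
        also have "\<dots> = V y - V x"
          using xy(1) subsetD[OF xy(2)] DERIV_subset[OF V xy(2)]
          by (intro integral_unique fundamental_theorem_of_calculus)
             (auto simp flip: has_real_derivative_iff_has_vector_derivative)
        finally show ?thesis .
      qed
      with 3 show ?thesis
        using weighted_avg_eq_moll[OF \<rho>(1) cl(2) cr(2), of "pert_node1 i" v "-1" 1]
        by (simp add: pert_node1_def)
    qed
  qed
  have avg_lincomb: "weighted_avg \<rho> (pert_node1 i) (\<lambda>x. a * u x + b * v x)
      = a * weighted_avg \<rho> (pert_node1 i) u + b * weighted_avg \<rho> (pert_node1 i) v"
    if \<rho>: "0 < \<rho>" "\<rho> \<le> 1 / 3"
      and u: "continuous_on (I_ext \<rho>) u" and v: "continuous_on (I_ext \<rho>) v"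
    for \<rho> u v i a b
  proof -
    obtain U where U: "\<And>x. x \<in> I_ext \<rho> \<Longrightarrow> (U has_real_derivative u x) (at x within I_ext \<rho>)"
      using u by (rule I_ext_antiderivative) blast
    obtain V where V: "\<And>x. x \<in> I_ext \<rho> \<Longrightarrow> (V has_real_derivative v x) (at x within I_ext \<rho>)"
      using v by (rule I_ext_antiderivative) blast
    note sub = I_ext_subset[OF \<rho>]
    have cont: "continuous_on {- \<rho>..\<rho>} w" "continuous_on {1 - \<rho>..1 + \<rho>} w"
      if "continuous_on (I_ext \<rho>) w" for w :: "real \<Rightarrow> real"
      using that sub by (auto intro: continuous_on_subset)
    have uv: "continuous_on (I_ext \<rho>) (\<lambda>x. a * u x + b * v x)" by (intro continuous_intros u v)
    \<comment> \<open>The combination of the antiderivatives is itself an admissible choice in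
      \<open>avg\<close>, which makes linearity of the third functional visible.\<close>
    have UV: "((\<lambda>x. a * U x + b * V x) has_real_derivative a * u x + b * v x) (at x within I_ext \<rho>)"
      if "x \<in> I_ext \<rho>" for x
      using that by (intro DERIV_add DERIV_cmult U V)
    note C = u v DERIV_continuous_on[OF U] DERIV_continuous_on[OF V]
    show ?thesis
      by (simp add: avg[OF \<rho> u U] avg[OF \<rho> v V]
        avg[OF \<rho> uv UV] moll_lincomb cont C \<rho>) (simp add: algebra_simps)
  qed
  have bound: "\<exists>C\<ge>0. \<forall>v. continuous_on (I_ext \<rho>) v \<longrightarrow>
      \<bar>weighted_avg \<rho> (pert_node1 i) v\<bar> \<le> C * integral (I_ext \<rho>) (\<lambda>x. \<bar>v x\<bar>)"
    if \<rho>: "0 < \<rho>" "\<rho> \<le> 1 / 3" for \<rho> i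
  proof -
    have sub: "{0 - \<rho>..0 + \<rho>} \<subseteq> {- \<rho>..1 + \<rho>}" "{1 - \<rho>..1 + \<rho>} \<subseteq> {- \<rho>..1 + \<rho>}"
      using \<rho> by auto
    obtain C1 where C1: "0 \<le> C1" "\<And>g. continuous_on (I_ext \<rho>) g \<Longrightarrow>
        \<bar>moll 0 \<rho> g\<bar> \<le> C1 * integral (I_ext \<rho>) (\<lambda>x. \<bar>g x\<bar>)"
      unfolding I_ext_def by (rule moll_L1_bound[OF \<rho>(1) sub(1)]) blast
    obtain C2 where C2: "0 \<le> C2" "\<And>g. continuous_on (I_ext \<rho>) g \<Longrightarrow>
        \<bar>moll 1 \<rho> g\<bar> \<le> C2 * integral (I_ext \<rho>) (\<lambda>x. \<bar>g x\<bar>)"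
      unfolding I_ext_def by (rule moll_L1_bound[OF \<rho>(1) sub(2)]) blast
    \<comment> \<open>The 2 accounts for the two mollified values of \<open>V\<close>, each at most
      the L1 norm of \<open>v\<close>.\<close>
    have "\<bar>weighted_avg \<rho> (pert_node1 i) v\<bar> \<le> (C1 + C2 + 2) * integral (I_ext \<rho>) (\<lambda>x. \<bar>v x\<bar>)"
      if v: "continuous_on (I_ext \<rho>) v" for v
    proof -
      let ?J = "integral (I_ext \<rho>) (\<lambda>x. \<bar>v x\<bar>)"
      obtain V where V: "\<And>x. x \<in> I_ext \<rho> \<Longrightarrow> (V has_real_derivative v x) (at x within I_ext \<rho>)"
        "\<And>x. x \<in> I_ext \<rho> \<Longrightarrow> \<bar>V x\<bar> \<le> ?J"
        using v by (rule I_ext_antiderivative) blast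
      have cV: "continuous_on {- \<rho>..1 + \<rho>} V"
        using DERIV_continuous_on[OF V(1)] by (simp add: I_ext_def)
      have moll_V: "\<bar>moll c \<rho> V\<bar> \<le> ?J" if "{c - \<rho>..c + \<rho>} \<subseteq> {- \<rho>..1 + \<rho>}" for c
      proof (rule moll_abs_le[OF \<rho>(1)])
        show "continuous_on {c - \<rho>..c + \<rho>} V" using cV that by (rule continuous_on_subset)
        show "\<bar>V x\<bar> \<le> ?J" if "x \<in> {c - \<rho>..c + \<rho>}" for x
          using subsetD[OF \<open>{c - \<rho>..c + \<rho>} \<subseteq> _\<close> that] by (intro V(2)) (simp add: I_ext_def)
      qed
      let ?R = "(C1 + C2 + 2) * ?J"
      have "0 \<le> ?J" using moll_V[OF sub(1)] by linarith
      then have "0 \<le> C1 * ?J" "0 \<le> C2 * ?J" using C1(1) C2(1) by auto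
      with \<open>0 \<le> ?J\<close> have R: "C1 * ?J \<le> ?R" "C2 * ?J \<le> ?R" "?J + ?J \<le> ?R"
        by (simp_all add: distrib_right)
      have "\<bar>moll 0 \<rho> v\<bar> \<le> ?R" using C1(2)[OF v] R(1) by (rule order_trans)
      moreover have "\<bar>moll 1 \<rho> v\<bar> \<le> ?R" using C2(2)[OF v] R(2) by (rule order_trans)
      moreover have "\<bar>moll 1 \<rho> V\<bar> + \<bar>moll 0 \<rho> V\<bar> \<le> ?R"
        using add_mono[OF moll_V[OF sub(2)] moll_V[OF sub(1)]] R(3) by (rule order_trans)
      then have "\<bar>moll 1 \<rho> V - moll 0 \<rho> V\<bar> \<le> ?R"
        by (rule order_trans[OF abs_triangle_ineq4])
      moreover have "weighted_avg \<rho> (pert_node1 i) v =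
          (if i = 1 then moll 0 \<rho> v else if i = 2 then moll 1 \<rho> v else moll 1 \<rho> V - moll 0 \<rho> V)"
        using \<rho> v V(1) by (rule avg)
      ultimately show ?thesis by (simp only: split: if_split) blast
    qed
    with C1 C2 show ?thesis by (intro exI[of _ "C1 + C2 + 2"]) auto
  qed
  have eq: "weighted_node1 \<rho> i v = weighted_avg \<rho> (pert_node1 i) v"
    if \<rho>: "0 < \<rho>" "\<rho> \<le> 1 / 3" and v: "continuous_on (I_ext \<rho>) v" for \<rho> v i
  proof -
    obtain C where C: "0 \<le> C" "\<And>v. continuous_on (I_ext \<rho>) v \<Longrightarrow>
      \<bar>weighted_avg \<rho> (pert_node1 i) v\<bar> \<le> C * integral (I_ext \<rho>) (\<lambda>x. \<bar>v x\<bar>)"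
      using bound[OF \<rho>] by blast
    show ?thesis
      unfolding weighted_node1_def I_ext_def
    proof (rule L2_extension_eq, fold I_ext_def)
      fix w :: "real \<Rightarrow> real" assume "w \<in> {v. continuous_on (I_ext \<rho>) v}"
      then show w: "continuous_on (I_ext \<rho>) w" by simp
      have "continuous_on (I_ext \<rho>) (\<lambda>x. 1 * w x + (- 1) * v x)" by (intro continuous_intros w v)
      from C(2)[OF this]
      show "\<bar>weighted_avg \<rho> (pert_node1 i) w - weighted_avg \<rho> (pert_node1 i) v\<bar>
          \<le> C * integral (I_ext \<rho>) (\<lambda>x. \<bar>w x - v x\<bar>)"
        using avg_lincomb[OF \<rho> w v, of i 1 "-1"] by simp
    qed (use \<rho> C v in auto)
  qed
  show "weighted_node1 \<rho> i (\<lambda>x. a * u x + b * v x)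
      = a * weighted_node1 \<rho> i u + b * weighted_node1 \<rho> i v"
    if "0 < \<rho>" "\<rho> \<le> 1 / 3" "continuous_on (I_ext \<rho>) u" "continuous_on (I_ext \<rho>) v"
    for \<rho> u v i a b
  proof -
    have "continuous_on (I_ext \<rho>) (\<lambda>x. a * u x + b * v x)"
      using that by (intro continuous_intros)
    with that show ?thesis by (simp add: eq avg_lincomb)
  qed
  show "((\<lambda>\<rho>. weighted_node1 \<rho> i v) \<longlongrightarrow> node1 i v) (at 0 within {0<..1/3})"
    if v: "continuous_on (I_ext (1 / 3)) v" for v i
  proof -
    \<comment> \<open>One antiderivative on the largest interval serves every \<open>\<rho>\<close>,
      so the limit concerns a function that does not vary with \<open>\<rho>\<close>.\<close>
    obtain V where V: "\<And>x. x \<in> I_ext (1/3) \<Longrightarrow> (V has_real_derivative v x) (at x within I_ext (1/3))"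
      using v by (rule I_ext_antiderivative) blast
    have sub: "{0..1} \<subseteq> I_ext (1/3)" by (simp add: I_ext_def)
    note lim = moll_tendsto_I_ext[OF v] moll_tendsto_I_ext[OF DERIV_continuous_on[OF V]]
    have "(LINT t|lebesgue_on {0..1}. v t) = integral {0..1} v"
      by (intro lebesgue_integral_eq_integral continuous_imp_integrable_real
          continuous_on_subset[OF v sub]) auto
    also have "\<dots> = V 1 - V 0"
      using subsetD[OF sub] DERIV_subset[OF V sub]
      by (intro integral_unique fundamental_theorem_of_calculus)
         (auto simp flip: has_real_derivative_iff_has_vector_derivative)
    finally have node3: "(LINT t|lebesgue_on {0..1}. v t) = V 1 - V 0" .
    have "((\<lambda>\<rho>. if i = 1 then moll 0 \<rho> v else if i = 2 then moll 1 \<rho> v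
       else moll 1 \<rho> V - moll 0 \<rho> V) \<longlongrightarrow> node1 i v) (at 0 within {0<..1/3})"
      by (simp add: node1_def node3 lim tendsto_diff)
    moreover have "weighted_node1 \<rho> i v = (if i = 1 then moll 0 \<rho> v else if i = 2 then moll 1 \<rho> v
       else moll 1 \<rho> V - moll 0 \<rho> V)" if "\<rho> \<in> {0<..1/3}" for \<rho>
    proof -
      have sub: "I_ext \<rho> \<subseteq> I_ext (1/3)" using that by (auto simp: I_ext_def)
      have v': "continuous_on (I_ext \<rho>) v" using v sub by (rule continuous_on_subset)
      have V': "(V has_real_derivative v x) (at x within I_ext \<rho>)" if "x \<in> I_ext \<rho>" for x
        using that sub V by (blast intro: DERIV_subset)
      from that show ?thesis
        by (simp add: eq[OF _ _ v'] avg[OF _ _ v' V'])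
    qed
    ultimately show ?thesis
      by (elim Lim_transform_eventually) (auto simp: eventually_at_filter)
  qed
qed

subsection \<open>Polynomials\<close>

lemma poly_eq_sum_coeff:
  fixes p :: "real poly"
  assumes "degree p \<le> n"
  shows "poly p x = (\<Sum>i\<le>n. coeff p i * x ^ i)"
  unfolding poly_altdef
  by (rule sum.mono_neutral_left) (use assms in \<open>auto simp: not_le coeff_eq_0\<close>)

lemma poly_form_0: "poly_form 0 = {\<lambda>x. a + b * x + c * x^2 + d * x^3 | a b c d. True}"
proof (intro equalityI subsetI)
  fix p assume "p \<in> poly_form 0"
  then obtain q where q: "p = poly q" "degree q \<le> 3" by (auto simp: poly_form_def poly_space_def)
  have "p = (\<lambda>x. coeff q 0 + coeff q 1 * x + coeff q 2 * x^2 + coeff q 3 * x^3)"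
    unfolding q(1) poly_eq_sum_coeff[OF q(2)] by (simp add: eval_nat_numeral)
  then show "p \<in> {\<lambda>x. a + b * x + c * x^2 + d * x^3 | a b c d. True}" by blast
next
  fix p :: "real \<Rightarrow> real" assume "p \<in> {\<lambda>x. a + b * x + c * x^2 + d * x^3 | a b c d. True}"
  then obtain a b c d where p: "p = (\<lambda>x. a + b * x + c * x^2 + d * x^3)" by blast
  have "p = poly [:a, b, c, d:]" unfolding p by (auto simp: algebra_simps eval_nat_numeral)
  moreover have "degree [:a, b, c, d:] \<le> 3" by simp
  ultimately show "p \<in> poly_form 0" unfolding poly_form_def poly_space_def by auto
qed

lemma poly_form_1: "poly_form 1 = {\<lambda>x. a + b * x + c * x^2 | a b c. True}"
proof (intro equalityI subsetI)
  fix p assume "p \<in> poly_form 1"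
  then obtain q where q: "p = poly q" "degree q \<le> 2" by (auto simp: poly_form_def poly_space_def)
  have "p = (\<lambda>x. coeff q 0 + coeff q 1 * x + coeff q 2 * x^2)"
    unfolding q(1) poly_eq_sum_coeff[OF q(2)] by (simp add: eval_nat_numeral)
  then show "p \<in> {\<lambda>x. a + b * x + c * x^2 | a b c. True}" by blast
next
  fix p :: "real \<Rightarrow> real" assume "p \<in> {\<lambda>x. a + b * x + c * x^2 | a b c. True}"
  then obtain a b c where p: "p = (\<lambda>x. a + b * x + c * x^2)" by blast
  have "p = poly [:a, b, c:]" unfolding p by (auto simp: algebra_simps eval_nat_numeral)
  moreover have "degree [:a, b, c:] \<le> 2" by simp
  ultimately show "p \<in> poly_form 1" unfolding poly_form_def poly_space_def by auto
qed

section \<open>Node values as coordinates in the dual basis\<close>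

lemma sum_1_3: "(\<Sum>i=1..3. f i) = f 1 + f 2 + f (3::nat)"
  and sum_1_4: "(\<Sum>i=1..4. f i) = f 1 + f 2 + f 3 + f (4::nat)"
  for f :: "nat \<Rightarrow> real"
  by (simp_all add: eval_nat_numeral)

lemma node0_cubic:
  "node0 i (\<lambda>x. a + b * x + c * x^2 + d * x^3) =
    (if i = 1 then b else if i = 2 then b + 2 * c + 3 * d
     else if i = 3 then b + c + d else 2 * a + b + c + d)"
proof -
  have "vector_derivative (\<lambda>x. a + b * x + c * x^2 + d * x^3) (at x within {0..1})
      = b + 2 * c * x + 3 * d * x^2" if "x \<in> {0..1}" for x :: real
    using that
    by (intro vector_derivative_at_within_ivl)
       (auto intro!: derivative_eq_intros simp flip: has_real_derivative_iff_has_vector_derivative)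
  then show ?thesis by (simp add: node0_def)
qed

lemma node1_quadratic:
  "node1 i (\<lambda>x. a + b * x + c * x^2) =
    (if i = 1 then a else if i = 2 then a + b + c else a + b / 2 + c / 3)"
proof -
  have "((\<lambda>x. a + b * x + c * x^2) has_integral
      (a * 1 + b / 2 * 1^2 + c / 3 * 1^3) - (a * 0 + b / 2 * 0^2 + c / 3 * 0^3)) {0..1}"
    by (rule fundamental_theorem_of_calculus[where f = "\<lambda>x. a * x + b / 2 * x^2 + c / 3 * x^3"])
       (auto intro!: derivative_eq_intros simp flip: has_real_derivative_iff_has_vector_derivative)
  moreover have "(LINT x|lebesgue_on {0..1}. a + b * x + c * x^2)
      = integral {0..1} (\<lambda>x. a + b * x + c * x^2)"
    by (intro lebesgue_integral_eq_integral continuous_imp_integrable_real continuous_intros) auto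
  ultimately show ?thesis by (simp add: node1_def integral_unique)
qed

lemma interp_poly_form: "k \<in> {0, 1} \<Longrightarrow> p \<in> poly_form k \<Longrightarrow> interp k p = p"
proof (elim insertE emptyE)
  assume "k = 0" "p \<in> poly_form k"
  then obtain a b c d where "p = (\<lambda>x. a + b * x + c * x^2 + d * x^3)"
    using poly_form_0 by auto
  with \<open>k = 0\<close> show ?thesis
    unfolding interp_def sum_1_4 basis0_def by (simp add: node0_cubic, intro ext) (simp add: field_simps)
next
  assume "k = 1" "p \<in> poly_form k"
  then obtain a b c where "p = (\<lambda>x. a + b * x + c * x^2)"
    using poly_form_1 by auto
  with \<open>k = 1\<close> show ?thesis
    unfolding interp_def sum_1_3 basis1_def by (simp add: node1_quadratic, intro ext) (simp add: field_simps)
qed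

lemma sum_basis0:
  "(\<lambda>x. \<Sum>j=1..4. c j * basis0 j x) = (\<lambda>x. (c 4 - c 3) / 2 + c 1 * x
     + (3 * c 3 - 2 * c 1 - c 2) * x^2 + (c 1 + c 2 - 2 * c 3) * x^3)"
  unfolding sum_1_4 basis0_def by (rule ext) (simp add: field_simps)

lemma sum_basis1:
  "(\<lambda>x. \<Sum>j=1..3. c j * basis1 j x) = (\<lambda>x. c 1
     + (6 * c 3 - 4 * c 1 - 2 * c 2) * x + (3 * c 1 + 3 * c 2 - 6 * c 3) * x^2)"
  unfolding sum_1_3 basis1_def by (rule ext) (simp add: field_simps)

text \<open>This is the duality of nodes and basis functions, stated for whole combinations; in
  particular it makes coefficients unique.\<close>

lemma node0_sum_basis0: "i \<in> {1..4} \<Longrightarrow> node0 i (\<lambda>x. \<Sum>j=1..4. c j * basis0 j x) = c i"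
proof -
  assume "i \<in> {1..4}"
  then have "i = 1 \<or> i = 2 \<or> i = 3 \<or> i = 4" by auto
  then show ?thesis unfolding sum_basis0 node0_cubic by (auto simp: field_simps)
qed

lemma node1_sum_basis1: "i \<in> {1..3} \<Longrightarrow> node1 i (\<lambda>x. \<Sum>j=1..3. c j * basis1 j x) = c i"
proof -
  assume "i \<in> {1..3}"
  then have "i = 1 \<or> i = 2 \<or> i = 3" by auto
  then show ?thesis unfolding sum_basis1 node1_quadratic by (auto simp: field_simps)
qed

text \<open>Reproduction by \<open>interp\<close> shows that the node values of a cubic are its
  coordinates; the other inclusion is expansion into monomials.\<close>

lemma poly_form_0_span: "poly_form 0 = {\<lambda>x. \<Sum>i=1..4. c i * basis0 i x | c. True}"
proof (intro equalityI subsetI)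
  fix p assume "p \<in> poly_form 0"
  then have "(\<lambda>x. \<Sum>i=1..4. node0 i p * basis0 i x) = p"
    using interp_poly_form[of 0 p] by (simp add: interp_def)
  then show "p \<in> {\<lambda>x. \<Sum>i=1..4. c i * basis0 i x | c. True}"
    by (intro CollectI exI[of _ "\<lambda>i. node0 i p"]) simp
next
  fix p assume "p \<in> {\<lambda>x. \<Sum>i=1..4. c i * basis0 i x | c. True}"
  then show "p \<in> poly_form 0" unfolding sum_basis0 poly_form_0 by blast
qed

lemma poly_form_1_span: "poly_form 1 = {\<lambda>x. \<Sum>i=1..3. c i * basis1 i x | c. True}"
proof (intro equalityI subsetI)
  fix p assume "p \<in> poly_form 1"
  then have "(\<lambda>x. \<Sum>i=1..3. node1 i p * basis1 i x) = p"
    using interp_poly_form[of 1 p] by (simp add: interp_def)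
  then show "p \<in> {\<lambda>x. \<Sum>i=1..3. c i * basis1 i x | c. True}"
    by (intro CollectI exI[of _ "\<lambda>i. node1 i p"]) simp
next
  fix p assume "p \<in> {\<lambda>x. \<Sum>i=1..3. c i * basis1 i x | c. True}"
  then show "p \<in> poly_form 1" unfolding sum_basis1 poly_form_1 by blast
qed

subsection \<open>Invertibility near the identity\<close>

text \<open>Indices in \<open>{1..n}\<close> are transported to a finite type, where a square matrix
  with trivial kernel is known to be surjective. The type \<open>'n\<close> only carries the
  dimension.\<close>

lemma square_system_solvable:
  fixes A :: "nat \<Rightarrow> nat \<Rightarrow> real"
  assumes n: "n = CARD('n::finite)"
    and inj: "\<And>c. (\<And>i. i \<in> {1..n} \<Longrightarrow> (\<Sum>j=1..n. A i j * c j) = 0) \<Longrightarrow> \<forall>j\<in>{1..n}. c j = 0"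
  obtains d where "\<And>i. i \<in> {1..n} \<Longrightarrow> (\<Sum>j=1..n. A i j * d j) = b i"
proof -
  obtain h :: "'n \<Rightarrow> nat" where h: "bij_betw h UNIV {1..n}"
    using n by (metis card_atLeastAtMost diff_Suc_1 finite finite_atLeastAtMost finite_same_card_bij)
  define g where "g = inv_into UNIV h"
  have gh: "g (h r) = r" for r using h by (simp add: g_def bij_betw_def)
  have hg: "h (g i) = i" if "i \<in> {1..n}" for i
    using h that by (simp add: g_def bij_betw_def f_inv_into_f)
  have h_in: "h r \<in> {1..n}" for r using h by (auto simp: bij_betw_def)
  have sum_h: "(\<Sum>s\<in>UNIV. f (h s)) = (\<Sum>j=1..n. f j)" for f :: "nat \<Rightarrow> real"
    using h by (rule sum.reindex_bij_betw)
  define M :: "real^'n^'n" where "M = (\<chi> r s. A (h r) (h s))"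
  have M: "(M *v x) $ r = (\<Sum>j=1..n. A (h r) j * x $ g j)" for x r
    unfolding sum_h[symmetric] by (simp add: M_def matrix_vector_mult_def gh)
  have "x = 0" if "M *v x = 0" for x
  proof -
    have "(\<Sum>j=1..n. A i j * x $ g j) = 0" if "i \<in> {1..n}" for i
      using M[of x "g i"] \<open>M *v x = 0\<close> that by (simp add: hg)
    then have "\<forall>j\<in>{1..n}. x $ g j = 0" by (rule inj)
    then show ?thesis using h_in gh by (metis vec_eq_iff zero_index)
  qed
  then have "surj ((*v) M)"
    by (metis matrix_left_invertible_ker matrix_left_right_inverse matrix_right_invertible_surjective)
  then obtain y where y: "M *v y = (\<chi> r. b (h r))" by (metis surjD)
  have "(\<Sum>j=1..n. A i j * y $ g j) = b i" if "i \<in> {1..n}" for i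
    using M[of y "g i"] that by (simp add: y hg)
  then show ?thesis by (rule that)
qed

text \<open>If \<open>A c = 0\<close>, then \<open>- c\<close> is the image of \<open>c\<close>
  under \<open>A\<close> minus the identity, so each entry of \<open>c\<close> is at most
  \<open>T / (2 n)\<close> for the sum \<open>T\<close> of absolute values. Summing the
  \<open>n\<close> entries gives \<open>T \<le> T / 2\<close>.\<close>

lemma near_identity_inj:
  fixes A :: "nat \<Rightarrow> nat \<Rightarrow> real"
  assumes A: "\<And>i j. i \<in> {1..n} \<Longrightarrow> j \<in> {1..n} \<Longrightarrow>
      \<bar>A i j - (if i = j then 1 else 0)\<bar> < 1 / (2 * real n)"
    and c: "\<And>i. i \<in> {1..n} \<Longrightarrow> (\<Sum>j=1..n. A i j * c j) = 0"
  shows "\<forall>j\<in>{1..n}. c j = 0"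
proof (cases "n = 0")
  case False
  define T where "T = (\<Sum>j=1..n. \<bar>c j\<bar>)"
  have le: "\<bar>c i\<bar> \<le> 1 / (2 * real n) * T" if i: "i \<in> {1..n}" for i
  proof -
    have "(\<Sum>j=1..n. (A i j - (if i = j then 1 else 0)) * c j)
        = (\<Sum>j=1..n. A i j * c j) - (\<Sum>j=1..n. if i = j then c j else 0)"
      unfolding sum_subtractf[symmetric] by (rule sum.cong) (auto simp: algebra_simps)
    also have "\<dots> = - c i" using i c by (simp add: sum.delta')
    finally have "\<bar>c i\<bar> = \<bar>\<Sum>j=1..n. (A i j - (if i = j then 1 else 0)) * c j\<bar>" by simp
    also have "\<dots> \<le> (\<Sum>j=1..n. \<bar>(A i j - (if i = j then 1 else 0)) * c j\<bar>)" by (rule sum_abs)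
    also have "\<dots> \<le> (\<Sum>j=1..n. 1 / (2 * real n) * \<bar>c j\<bar>)"
      unfolding abs_mult by (intro sum_mono mult_right_mono less_imp_le[OF A[OF i]]) auto
    finally show ?thesis by (simp add: T_def sum_distrib_left)
  qed
  have "T \<le> (\<Sum>j=1..n. 1 / (2 * real n) * T)"
    by (subst T_def) (rule sum_mono[OF le])
  also have "\<dots> = T / 2" using False by simp
  finally have "T \<le> 0" by simp
  then have "T = 0" by (simp add: T_def antisym sum_nonneg)
  then show ?thesis
    using sum_nonneg_eq_0_iff[of "{1..n}" "\<lambda>j. \<bar>c j\<bar>"] by (simp add: T_def)
qed simp

text \<open>Linearity is available only on \<open>D\<close>, so the induction has to carry
  membership of the partial sums in \<open>D\<close> along.\<close>

lemma linear_functional_sum: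
  fixes L :: "('a \<Rightarrow> real) \<Rightarrow> real" and \<phi> :: "nat \<Rightarrow> 'a \<Rightarrow> real"
  assumes L: "\<And>a b u v. u \<in> D \<Longrightarrow> v \<in> D \<Longrightarrow> L (\<lambda>x. a * u x + b * v x) = a * L u + b * L v"
    and D: "\<And>a b u v. u \<in> D \<Longrightarrow> v \<in> D \<Longrightarrow> (\<lambda>x. a * u x + b * v x) \<in> D"
    and \<phi>: "\<And>j. \<phi> j \<in> D"
  shows "L (\<lambda>x. \<Sum>j=1..n. c j * \<phi> j x) = (\<Sum>j=1..n. c j * L (\<phi> j))"
proof -
  have "(\<lambda>x. \<Sum>j=1..n. c j * \<phi> j x) \<in> D
      \<and> L (\<lambda>x. \<Sum>j=1..n. c j * \<phi> j x) = (\<Sum>j=1..n. c j * L (\<phi> j))" for n :: nat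
  proof (induction n)
    case 0
    \<comment> \<open>The empty sum is the combination with both coefficients 0, which puts the zero
      function into \<open>D\<close>.\<close>
    show ?case using L[OF \<phi> \<phi>, of 0 _ 0] D[OF \<phi> \<phi>, of 0 _ 0] by simp
  next
    case (Suc n)
    then show ?case
      using L[OF conjunct1[OF Suc] \<phi>, of 1 "c (Suc n)" "Suc n"]
        D[OF conjunct1[OF Suc] \<phi>, of 1 "c (Suc n)" "Suc n"] by simp
  qed
  then show ?thesis by blast
qed

text \<open>Independent of the form degree: in coordinates the operator is the matrix
  \<open>W \<rho> i (\<phi> j)\<close>, whose entries tend to those of the identity by duality. A
  trivial kernel then gives injectivity and, by dimension, surjectivity.\<close>

lemma perturbed_interpolation_bij:
  fixes \<phi> :: "nat \<Rightarrow> 'a \<Rightarrow> real" and N :: "nat \<Rightarrow> ('a \<Rightarrow> real) \<Rightarrow> real"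
    and W :: "real \<Rightarrow> nat \<Rightarrow> ('a \<Rightarrow> real) \<Rightarrow> real"
  assumes n: "n = CARD('n::finite)" and r: "r > 0"
    and V: "V = {\<lambda>x. \<Sum>i=1..n. c i * \<phi> i x | c. True}"
    and dual: "\<And>c i. i \<in> {1..n} \<Longrightarrow> N i (\<lambda>x. \<Sum>j=1..n. c j * \<phi> j x) = c i"
    and lin: "\<And>\<rho> c i. \<rho> \<in> {0<..r} \<Longrightarrow>
      W \<rho> i (\<lambda>x. \<Sum>j=1..n. c j * \<phi> j x) = (\<Sum>j=1..n. c j * W \<rho> i (\<phi> j))"
    and lim: "\<And>p i. p \<in> V \<Longrightarrow> ((\<lambda>\<rho>. W \<rho> i p) \<longlongrightarrow> N i p) (at 0 within {0<..r})"
  shows "\<exists>\<rho>0\<in>{0<..r}. \<forall>\<rho>\<in>{0<..\<rho>0}. bij_betw (\<lambda>u x. \<Sum>i=1..n. W \<rho> i u * \<phi> i x) V V"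
proof -
  have \<phi>_eq: "\<phi> j = (\<lambda>x. \<Sum>i=1..n. (if i = j then 1 else 0) * \<phi> i x)" if "j \<in> {1..n}" for j
    using that by (simp add: if_distrib[of "\<lambda>t. t * _"] sum.delta cong: if_cong)
  have \<phi>V: "\<phi> j \<in> V" if "j \<in> {1..n}" for j
    unfolding V
    by (intro CollectI exI[of _ "\<lambda>i. if i = j then 1 else 0"] conjI TrueI \<phi>_eq that)
  have N\<phi>: "N i (\<phi> j) = (if i = j then 1 else 0)" if "i \<in> {1..n}" "j \<in> {1..n}" for i j
    by (subst \<phi>_eq[OF that(2)], subst dual[OF that(1)]) simp
  \<comment> \<open>The tolerance \<open>1 / (2 * n)\<close> is positive, and finitely many entries
    share a common neighbourhood of 0.\<close>
  have "n > 0" using n by simp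
  then have "\<forall>\<^sub>F \<rho> in at 0 within {0<..r}. \<forall>i\<in>{1..n}. \<forall>j\<in>{1..n}.
      \<bar>W \<rho> i (\<phi> j) - (if i = j then 1 else 0)\<bar> < 1 / (2 * real n)"
    using tendstoD[OF lim[OF \<phi>V], of _ "1 / (2 * real n)"]
    by (intro eventually_ball_finite ballI finite_atLeastAtMost)
       (simp add: dist_real_def flip: N\<phi>)
  then obtain d where d: "d > 0" and small: "\<And>\<rho>. \<rho> \<in> {0<..r} \<Longrightarrow> \<bar>\<rho>\<bar> < d \<Longrightarrow> \<forall>i\<in>{1..n}. \<forall>j\<in>{1..n}.
      \<bar>W \<rho> i (\<phi> j) - (if i = j then 1 else 0)\<bar> < 1 / (2 * real n)"
    unfolding eventually_at by (auto simp: dist_real_def)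
  \<comment> \<open>The neighbourhood is \<open>\<bar>\<rho>\<bar> < d\<close>, while the range of
    \<open>\<rho>\<close> includes its upper end; hence \<open>d / 2\<close>.\<close>
  have "bij_betw (\<lambda>u x. \<Sum>i=1..n. W \<rho> i u * \<phi> i x) V V" if "\<rho> \<in> {0<..min r (d / 2)}" for \<rho>
  proof -
    let ?\<Phi> = "\<lambda>c x. \<Sum>i=1..n. c i * \<phi> i x"
    let ?Q = "\<lambda>u. ?\<Phi> (\<lambda>i. W \<rho> i u)"
    define A where "A i j = W \<rho> i (\<phi> j)" for i j
    have \<rho>: "\<rho> \<in> {0<..r}" "\<bar>\<rho>\<bar> < d" using that d by auto
    have small: "\<bar>A i j - (if i = j then 1 else 0)\<bar> < 1 / (2 * real n)"
      if "i \<in> {1..n}" "j \<in> {1..n}" for i j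
      using small[OF \<rho>] that unfolding A_def by blast
    have W: "W \<rho> i (?\<Phi> c) = (\<Sum>j=1..n. A i j * c j)" for i c
      unfolding lin[OF \<rho>(1)] A_def by (simp add: mult.commute)
    have ker: "\<forall>j\<in>{1..n}. c j = 0"
      if "\<And>i. i \<in> {1..n} \<Longrightarrow> (\<Sum>j=1..n. A i j * c j) = 0" for c
      using small that by (rule near_identity_inj)
    have coord: "\<forall>i\<in>{1..n}. c i = e i" if "?\<Phi> c = ?\<Phi> e" for c e
    proof
      fix i assume i: "i \<in> {1..n}"
      from arg_cong[OF that, of "N i"] show "c i = e i" unfolding dual[OF i] .
    qed
    have "inj_on ?Q V"
    proof (rule inj_onI)
      fix u v assume "u \<in> V" "v \<in> V" and eq: "?Q u = ?Q v"
      then obtain c e where ce: "u = ?\<Phi> c" "v = ?\<Phi> e" unfolding V by blast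
      \<comment> \<open>Equal images have equal coefficients by duality, so the difference of the
        coordinate vectors lies in the kernel of \<open>A\<close>.\<close>
      have "(\<Sum>j=1..n. A i j * (c j - e j)) = 0" if "i \<in> {1..n}" for i
      proof -
        have "W \<rho> i u = W \<rho> i v" using coord[OF eq] that by blast
        then show ?thesis
          unfolding ce W by (simp add: right_diff_distrib sum_subtractf)
      qed
      from ker[OF this] show "u = v" unfolding ce by simp
    qed
    moreover have "?Q ` V = V"
    proof (intro equalityI subsetI)
      fix v assume "v \<in> ?Q ` V"
      then obtain u where v: "v = ?Q u" by (rule imageE)
      show "v \<in> V"
        unfolding V v by (intro CollectI exI[of _ "\<lambda>i. W \<rho> i u"] conjI TrueI refl)
    next
      fix v assume "v \<in> V"
      then obtain b where b: "v = ?\<Phi> b" unfolding V by blast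
      obtain e where e: "\<And>i. i \<in> {1..n} \<Longrightarrow> (\<Sum>j=1..n. A i j * e j) = b i"
      proof (rule square_system_solvable[where A = A and b = b, OF n])
        show "\<forall>j\<in>{1..n}. c j = 0"
          if "\<And>i. i \<in> {1..n} \<Longrightarrow> (\<Sum>j=1..n. A i j * c j) = 0" for c
          using that by (rule ker)
      qed (rule that)
      have "v = ?Q (?\<Phi> e)" unfolding b W using e by simp
      moreover have "?\<Phi> e \<in> V" unfolding V by blast
      ultimately show "v \<in> ?Q ` V" by blast
    qed
    ultimately show ?thesis by (simp add: bij_betw_def)
  qed
  then show ?thesis using r d by (intro bexI[of _ "min r (d / 2)"]) auto
qed

text \<open>The parameter enters only through finitely many scalar coefficients, so boundedness of
  the fixed functions makes convergence uniform.\<close>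

lemma uniform_limit_sum_mult:
  fixes f :: "'i \<Rightarrow> 'a \<Rightarrow> real"
  assumes f: "\<And>i. i \<in> I \<Longrightarrow> (f i \<longlongrightarrow> l i) F" and \<phi>: "\<And>i. i \<in> I \<Longrightarrow> bounded (\<phi> i ` S)"
  shows "uniform_limit S (\<lambda>a x. \<Sum>i\<in>I. f i a * \<phi> i x) (\<lambda>x. \<Sum>i\<in>I. l i * \<phi> i x) F"
proof -
  have "uniform_limit S (\<lambda>a x. f i a * \<phi> i x) (\<lambda>x. l i * \<phi> i x) F" if i: "i \<in> I" for i
  proof (rule uniform_lim_mult)
    show "uniform_limit S (\<lambda>a x. f i a) (\<lambda>x. l i) F"
      using tendstoD[OF f[OF i]] by (auto intro!: uniform_limitI elim!: eventually_mono)
    show "bounded ((\<lambda>_. l i) ` S)" by (rule boundedI[of _ "norm (l i)"]) auto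
  qed (use \<phi> i in \<open>auto intro: uniform_limit_intros\<close>)
  then show ?thesis
    by (induction I rule: infinite_finite_induct)
      (auto intro!: uniform_limit_add uniform_limit_const)
qed

subsection \<open>Quasi-interpolation of polynomials\<close>

lemma C1_differentiable_on_poly_form_0: "p \<in> poly_form 0 \<Longrightarrow> p C1_differentiable_on S"
proof -
  assume "p \<in> poly_form 0"
  then obtain q where q: "p = poly q" by (auto simp: poly_form_def poly_space_def)
  have "(poly q has_vector_derivative poly (pderiv q) x) (at x)" for x
    using poly_DERIV[of q x] by (simp add: has_real_derivative_iff_has_vector_derivative)
  then show ?thesis
    unfolding q C1_differentiable_on_def
    by (intro exI[of _ "poly (pderiv q)"]) (auto intro: continuous_intros)
qed

lemma continuous_on_poly_form: "p \<in> poly_form k \<Longrightarrow> continuous_on S p"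
  by (auto simp: poly_form_def poly_space_def intro: continuous_intros split: if_splits)

lemma basis0_C1: "basis0 i C1_differentiable_on S"
  unfolding basis0_def[abs_def]
  by (cases "i = 1"; cases "i = 2"; cases "i = 3")
     (auto simp: power2_eq_square power3_eq_cube intro!: derivative_intros)

lemma basis1_continuous: "continuous_on S (basis1 i)"
  unfolding basis1_def[abs_def]
  by (cases "i = 1"; cases "i = 2") (auto intro!: continuous_intros)

text \<open>The polynomial spaces are finite-dimensional, so uniform convergence on [0,1] expresses
  convergence in any norm on them. The operators are linear on these spaces, so bijectivity
  expresses invertibility.\<close>

theorem mainTheorem5:
  fixes k :: nat
  assumes "k \<in> {0, 1}"
  shows "(\<forall>p \<in> poly_form k.
            uniform_limit {0..1} (\<lambda>\<rho>. quasi_interp k \<rho> p) (interp k p) (at 0 within {0<..1/3})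
            \<and> interp k p = p)
       \<and> (\<exists>\<rho>0 \<in> {0<..1/3}. \<forall>\<rho> \<in> {0<..\<rho>0}.
            bij_betw (quasi_interp k \<rho>) (poly_form k) (poly_form k)
            \<and> (\<forall>p \<in> poly_form k. quasi_interp_hat k \<rho> p = p))"
proof -
  have unif: "uniform_limit {0..1} (\<lambda>\<rho>. quasi_interp k \<rho> p) (interp k p) (at 0 within {0<..1/3})"
    if p: "p \<in> poly_form k" for p
  proof (cases "k = 0")
    case True
    have "bounded (basis0 i ` {0..1})" for i
      using C1_differentiable_on_deriv(3)[OF basis0_C1]
      by (intro compact_imp_bounded compact_continuous_image) auto
    then have "uniform_limit {0..1} (\<lambda>\<rho> x. \<Sum>i=1..4. weighted_node0 \<rho> i p * basis0 i x)
        (\<lambda>x. \<Sum>i=1..4. node0 i p * basis0 i x) (at 0 within {0<..1/3})"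
      using p True
      by (intro uniform_limit_sum_mult weighted_node0_tendsto C1_differentiable_on_poly_form_0) auto
    then show ?thesis using True by (simp add: quasi_interp_def interp_def)
  next
    case False
    have "bounded (basis1 i ` {0..1})" for i
      using basis1_continuous by (intro compact_imp_bounded compact_continuous_image) auto
    then have "uniform_limit {0..1} (\<lambda>\<rho> x. \<Sum>i=1..3. weighted_node1 \<rho> i p * basis1 i x)
        (\<lambda>x. \<Sum>i=1..3. node1 i p * basis1 i x) (at 0 within {0<..1/3})"
      by (intro uniform_limit_sum_mult weighted_node1_tendsto continuous_on_poly_form[OF p]) auto
    then show ?thesis using False by (simp add: quasi_interp_def interp_def)
  qed
  have "\<exists>\<rho>0\<in>{0<..1/3}. \<forall>\<rho>\<in>{0<..\<rho>0}. bij_betw (quasi_interp k \<rho>) (poly_form k) (poly_form k)"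
  proof (cases "k = 0")
    case True
    have "\<exists>\<rho>0\<in>{0<..1/3}. \<forall>\<rho>\<in>{0<..\<rho>0}.
        bij_betw (\<lambda>u x. \<Sum>i=1..4. weighted_node0 \<rho> i u * basis0 i x) (poly_form 0) (poly_form 0)"
    \<comment> \<open>The numeral type \<open>4\<close> has four elements and supplies the matrix
      index type.\<close>
    proof (rule perturbed_interpolation_bij[where 'n = 4 and N = node0])
      fix \<rho> :: real and c :: "nat \<Rightarrow> real" and i :: nat assume \<rho>: "\<rho> \<in> {0<..1/3}"
      show "weighted_node0 \<rho> i (\<lambda>x. \<Sum>j=1..4. c j * basis0 j x)
          = (\<Sum>j=1..4. c j * weighted_node0 \<rho> i (basis0 j))"
        by (rule linear_functional_sum[where D = "{u. u C1_differentiable_on I_ext \<rho>}"])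
           (use \<rho> in \<open>auto simp: weighted_node0_lincomb
              C1_differentiable_on_lincomb basis0_C1\<close>)
    qed (simp, simp, rule poly_form_0_span, rule node0_sum_basis0, assumption,
        intro weighted_node0_tendsto C1_differentiable_on_poly_form_0)
    then show ?thesis using True by (simp add: quasi_interp_def[abs_def])
  next
    case False
    with assms have k: "k = 1" by simp
    have "\<exists>\<rho>0\<in>{0<..1/3}. \<forall>\<rho>\<in>{0<..\<rho>0}.
        bij_betw (\<lambda>u x. \<Sum>i=1..3. weighted_node1 \<rho> i u * basis1 i x) (poly_form 1) (poly_form 1)"
    proof (rule perturbed_interpolation_bij[where 'n = 3 and N = node1])
      fix \<rho> :: real and c :: "nat \<Rightarrow> real" and i :: nat assume \<rho>: "\<rho> \<in> {0<..1/3}"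
      show "weighted_node1 \<rho> i (\<lambda>x. \<Sum>j=1..3. c j * basis1 j x)
          = (\<Sum>j=1..3. c j * weighted_node1 \<rho> i (basis1 j))"
        by (rule linear_functional_sum[where D = "{v. continuous_on (I_ext \<rho>) v}"])
           (use \<rho> in \<open>auto simp: weighted_node1_lincomb
              basis1_continuous intro!: continuous_intros\<close>)
    qed (simp, simp, rule poly_form_1_span, rule node1_sum_basis1, assumption,
        intro weighted_node1_tendsto continuous_on_poly_form)
    then show ?thesis using k by (simp add: quasi_interp_def[abs_def])
  qed
  \<comment> \<open>On a bijection of \<open>poly_form k\<close> the function
    \<open>inv_into\<close> is a genuine left inverse, which is the projection property.\<close>
  moreover have "quasi_interp_hat k \<rho> p = p"
    if "bij_betw (quasi_interp k \<rho>) (poly_form k) (poly_form k)" "p \<in> poly_form k" for \<rho> p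
    using that by (simp add: quasi_interp_hat_def bij_betw_def)
  ultimately show ?thesis
    using unif interp_poly_form[OF assms] by blast
qed

end
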